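(* Let $\Omega_q\subseteq\mathbb{H}$ be an axially symmetric connected open set with $\Omega_q\cap\mathbb{R}=\emptyset$, let $T_1,T_2\in B_1^{s}(\Omega_q)$, and let $\omega_0\in\Omega_{red}$. Let $N_1(\omega_0)$ and $N_2(\omega_0)$ be canonical matrix representations of $T_1$ and $T_2$ at $\omega_0$, respectively. Then $T_1$ and $T_2$ are quaternion unitarily equivalent if and only if there exists $\theta\in[0,2\pi)$ such that $N_2(\omega_0)=\mathrm{e}^{-\boldsymbol{i}\theta}\cdot N_1(\omega_0)\cdot\mathrm{e}^{\boldsymbol{i}\theta}$.
   Context: $\mathbb{H}$ denotes the quaternions with units $\boldsymbol{i},\boldsymbol{j},\boldsymbol{k}$; $\mathbb{C}$ is identified with $\{a+b\boldsymbol{i}\}\subset\mathbb{H}$. For $p,q\in\mathbb{H}$, $p\sim q$ means $|p|=|q|$ and $\mathrm{Re}(p)=\mathrm{Re}(q)$; a subset of $\mathbb{H}$ is axially symmetric if it contains, with each $x$, all $y\sim x$. $\Omega_{red}=\{\mathrm{Re}(\omega)+\boldsymbol{i}|\mathrm{Im}(\omega)|:\omega\in\Omega_q\}\subset\mathbb{C}$. $\mathcal{H}_q$ is a separable quaternionic Hilbert space (right $\mathbb{H}$-vector space, inner product $\langle\cdot,\cdot\rangle_{\mathbb{H}}$ with $\langle x,y\rangle_{\mathbb H}=\overline{\langle y,x\rangle_{\mathbb H}}$ and $\langle xp+yq,z\rangle_{\mathbb H}=\langle x,z\rangle_{\mathbb H}p+\langle y,z\rangle_{\mathbb H}q$). $L_r(\mathcal{H}_q)$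 is the set of bounded right $\mathbb{H}$-linear operators. $\bigvee_{\mathbb{H}}$ denotes closed right $\mathbb{H}$-linear span. $\sigma_s(T)=\{s\in\mathbb{H}: T^2-2\mathrm{Re}(s)T+|s|^2\boldsymbol{I}\text{ is not invertible}\}$. $B_1^s(\Omega_q)$ is the set of $T\in L_r(\mathcal{H}_q)$ with: (a) $\Omega_q\subseteq\sigma_s(T)$; (b) $\mathrm{ran}(T^2-2\mathrm{Re}(\omega)T+|\omega|^2)=\mathcal{H}_q$ for all $\omega\in\Omega_q$; (c) $\bigvee_{\mathbb{H}}\{\ker(T^2-2\mathrm{Re}(\omega)T+|\omega|^2):\omega\in\Omega_q\}=\mathcal{H}_q$; (d) $\dim_{\mathbb{H}}\ker(T^2-2\mathrm{Re}(\omega)T+|\omega|^2)=1$ for all $\omega\in\Omega_q$. A map $\gamma$ from an open set of $\mathbb{C}$ to $\mathcal{H}_q$ is right holomorphic if $\gamma'(z)=\lim_{h\to0}(\gamma(z+h)-\gamma(z))h^{-1}$ exists ($h\in\mathbb{C}\setminus\{0\}$) at every point; $\gamma^{(i)}$ is the $i$-th derivative. For $T\in B_1^s(\Omega_q)$, a right holomorphic frame of $E_T$ over an open set $\Delta\subseteq\Omega_{red}$ is a nowhere vanishing right holomorphic $\gamma:\Delta\to\mathcal{H}_q$ with $\gamma(\omega)\in\ker(T^2-2\mathrm{Re}(\omega)T+|\omega|^2)$ for all $\omega\in\Delta$. Canonical matrix representation of $T$ at $\omega_0$: choose a right holomorphic frame $\gamma$ of $E_T$ over a neighbourhood of $\omega_0$;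 apply Gram–Schmidt to $\{\gamma^{(i)}(\omega_0)\}_{i=0}^\infty$, i.e. $e_0(\omega_0)=\gamma(\omega_0)/\|\gamma(\omega_0)\|$ and, for $i\ge1$, $e_i(\omega_0)=v_i/\|v_i\|$ with $v_i=\gamma^{(i)}(\omega_0)-\sum_{k=0}^{i-1}e_k(\omega_0)\langle\gamma^{(i)}(\omega_0),e_k(\omega_0)\rangle_{\mathbb{H}}$. This gives an orthonormal basis of $\mathcal{H}_q$, and $N(\omega_0)$ is the quaternionic matrix of $T$ in this basis, with $(j,k)$ entry $\langle Te_k(\omega_0),e_j(\omega_0)\rangle_{\mathbb{H}}$, $j,k\ge0$. (It depends on $\gamma$ only up to $N(\omega_0)\mapsto\mathrm{e}^{-\boldsymbol{i}\theta}N(\omega_0)\mathrm{e}^{\boldsymbol{i}\theta}$, $\theta\in\mathbb{R}$.) For a quaternionic matrix $N$, $\mathrm{e}^{-\boldsymbol{i}\theta}\cdot N\cdot\mathrm{e}^{\boldsymbol{i}\theta}$ is taken entrywise. $T_1,T_2$ are quaternion unitarily equivalent if there is $U\in L_r(\mathcal{H}_q)$ with $U^*U=UU^*=\boldsymbol{I}$ and $UT_1=T_2U$. *)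

theory Defs
  imports "HOL-Analysis.Analysis"
begin

section \<open>Quaternions\<close>

datatype quat = Quat (qre: real) (qi: real) (qj: real) (qk: real)

lemma quat_eq_iff: "p = q \<longleftrightarrow> qre p = qre q \<and> qi p = qi q \<and> qj p = qj q \<and> qk p = qk q"
  by (cases p; cases q) simp

instantiation quat :: real_vector
begin

definition "0 = Quat 0 0 0 0"
definition "p + q = Quat (qre p + qre q) (qi p + qi q) (qj p + qj q) (qk p + qk q)"
definition "- p = Quat (- qre p) (- qi p) (- qj p) (- qk p)"
definition "p - q = Quat (qre p - qre q) (qi p - qi q) (qj p - qj q) (qk p - qk q)"
definition "scaleR r p = Quat (r * qre p) (r * qi p) (r * qj p) (r * qk p)"

instance
  by standard (simp_all add: zero_quat_def plus_quat_def uminus_quat_def minus_quat_def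
      scaleR_quat_def algebra_simps)

end

lemma quat_add_sel [simp]:
  "qre (p + q) = qre p + qre q" "qi (p + q) = qi p + qi q"
  "qj (p + q) = qj p + qj q" "qk (p + q) = qk p + qk q"
  by (simp_all add: plus_quat_def)

lemma quat_zero_sel [simp]: "qre 0 = 0" "qi 0 = 0" "qj 0 = 0" "qk 0 = 0"
  by (simp_all add: zero_quat_def)

lemma quat_uminus_sel [simp]:
  "qre (- p) = - qre p" "qi (- p) = - qi p" "qj (- p) = - qj p" "qk (- p) = - qk p"
  by (simp_all add: uminus_quat_def)

lemma quat_minus_sel [simp]:
  "qre (p - q) = qre p - qre q" "qi (p - q) = qi p - qi q"
  "qj (p - q) = qj p - qj q" "qk (p - q) = qk p - qk q"
  by (simp_all add: minus_quat_def)

lemma quat_scaleR_sel [simp]: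
  "qre (r *\<^sub>R p) = r * qre p" "qi (r *\<^sub>R p) = r * qi p"
  "qj (r *\<^sub>R p) = r * qj p" "qk (r *\<^sub>R p) = r * qk p"
  by (simp_all add: scaleR_quat_def)

instantiation quat :: real_inner
begin

definition "inner p q = qre p * qre q + qi p * qi q + qj p * qj q + qk p * qk q"
definition norm_quat_def: "norm (p :: quat) = sqrt (inner p p)"
definition sgn_quat_def: "sgn p = p /\<^sub>R norm (p :: quat)"
definition dist_quat_def: "dist p q = norm (p - q :: quat)"
definition uniformity_quat_def [code del]:
  "(uniformity :: (quat \<times> quat) filter) = (INF e\<in>{0 <..}. principal {(x, y). dist x y < e})"
definition open_quat_def [code del]:
  "open (U :: quat set) \<longleftrightarrow> (\<forall>x\<in>U. eventually (\<lambda>(x', y). x' = x \<longrightarrow> y \<in> U) uniformity)"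

instance
proof
  fix p :: quat
  have *: "inner p p = (qre p)\<^sup>2 + (qi p)\<^sup>2 + (qj p)\<^sup>2 + (qk p)\<^sup>2"
    by (simp add: inner_quat_def power2_eq_square)
  show "0 \<le> inner p p"
    by (simp add: *)
  have "inner p p = 0 \<longleftrightarrow> qre p = 0 \<and> qi p = 0 \<and> qj p = 0 \<and> qk p = 0"
    unfolding * by (simp add: add_nonneg_eq_0_iff)
  then show "inner p p = 0 \<longleftrightarrow> p = 0"
    by (simp add: quat_eq_iff)
qed (simp_all add: inner_quat_def algebra_simps norm_quat_def sgn_quat_def dist_quat_def
    uniformity_quat_def open_quat_def)

end

definition qcnj :: "quat \<Rightarrow> quat"
  where "qcnj q = Quat (qre q) (- qi q) (- qj q) (- qk q)"

lemma qcnj_sel [simp]: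
  "qre (qcnj q) = qre q" "qi (qcnj q) = - qi q" "qj (qcnj q) = - qj q" "qk (qcnj q) = - qk q"
  by (simp_all add: qcnj_def)

lemma quat_norm_squared: "(norm q)\<^sup>2 = (qre q)\<^sup>2 + (qi q)\<^sup>2 + (qj q)\<^sup>2 + (qk q)\<^sup>2"
  by (simp add: norm_quat_def inner_quat_def power2_eq_square)

instantiation quat :: real_normed_div_algebra
begin

definition "1 = Quat 1 0 0 0"
definition "p * q = Quat
  (qre p * qre q - qi p * qi q - qj p * qj q - qk p * qk q)
  (qre p * qi q + qi p * qre q + qj p * qk q - qk p * qj q)
  (qre p * qj q - qi p * qk q + qj p * qre q + qk p * qi q)
  (qre p * qk q + qi p * qj q - qj p * qi q + qk p * qre q)"
definition "inverse q = qcnj q /\<^sub>R (norm (q :: quat))\<^sup>2"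
definition "p div q = p * inverse (q :: quat)"

instance
proof
  fix p q r :: quat and a :: real
  show "p * q * r = p * (q * r)" "(p + q) * r = p * r + q * r" "p * (q + r) = p * q + p * r"
    "1 * p = p" "p * 1 = p" "(0::quat) \<noteq> 1" "a *\<^sub>R p * q = a *\<^sub>R (p * q)" "p * a *\<^sub>R q = a *\<^sub>R (p * q)"
    by (simp_all add: quat_eq_iff times_quat_def one_quat_def algebra_simps)
  have *: "p * qcnj p = (norm p)\<^sup>2 *\<^sub>R 1" "qcnj p * p = (norm p)\<^sup>2 *\<^sub>R 1"
    by (simp_all add: quat_eq_iff times_quat_def one_quat_def quat_norm_squared)
      (simp_all add: power2_eq_square)
  have scl: "x * a *\<^sub>R y = a *\<^sub>R (x * y)" "a *\<^sub>R x * y = a *\<^sub>R (x * y)" for a and x y :: quat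
    by (simp_all add: quat_eq_iff times_quat_def algebra_simps)
  show "inverse p * p = 1" "p * inverse p = 1" if "p \<noteq> 0"
    using that by (simp_all add: inverse_quat_def scl *)
  show "inverse (0::quat) = 0"
    by (simp add: inverse_quat_def)
  show "p div q = p * inverse q"
    by (simp add: divide_quat_def)
  have "(norm (p * q))\<^sup>2 = (norm p * norm q)\<^sup>2"
    unfolding power_mult_distrib quat_norm_squared
    by (simp add: times_quat_def power2_eq_square algebra_simps)
  then show "norm (p * q) = norm p * norm q"
    by (simp add: power2_eq_iff_nonneg)
qed

end

definition quat_of_complex :: "complex \<Rightarrow> quat"
  where "quat_of_complex z = Quat (Re z) (Im z) 0 0"

definition qvec :: "quat \<Rightarrow> quat"
  where "qvec q = Quat 0 (qi q) (qj q) (qk q)"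

definition qsim :: "quat \<Rightarrow> quat \<Rightarrow> bool"
  where "qsim p q \<longleftrightarrow> norm p = norm q \<and> qre p = qre q"

definition axially_symmetric :: "quat set \<Rightarrow> bool"
  where "axially_symmetric S \<longleftrightarrow> (\<forall>x\<in>S. \<forall>y. qsim y x \<longrightarrow> y \<in> S)"

definition reduced :: "quat set \<Rightarrow> complex set"
  where "reduced S = (\<lambda>w. Complex (qre w) (norm (qvec w))) ` S"


section \<open>Right quaternionic inner product spaces\<close>

text \<open>
  The inner product is right linear in its \<^emph>\<open>first\<close> argument.  The real vector space structure
  and the norm are tied to the quaternionic data by \<open>qscale_of_real\<close> and \<open>qinner_self\<close>.
  A quaternionic Hilbert space is a \<open>quat_inner\<close> space that is also a \<open>complete_space\<close>.
\<close>

class quat_inner = real_normed_vector +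
  fixes qscale :: "'a \<Rightarrow> quat \<Rightarrow> 'a" (infixl "\<cdot>\<^sub>q" 75)
    and qinner :: "'a \<Rightarrow> 'a \<Rightarrow> quat"
  assumes qscale_add_left: "(x + y) \<cdot>\<^sub>q p = x \<cdot>\<^sub>q p + y \<cdot>\<^sub>q p"
    and qscale_add_right: "x \<cdot>\<^sub>q (p + q) = x \<cdot>\<^sub>q p + x \<cdot>\<^sub>q q"
    and qscale_qscale: "(x \<cdot>\<^sub>q p) \<cdot>\<^sub>q q = x \<cdot>\<^sub>q (p * q)"
    and qscale_of_real: "x \<cdot>\<^sub>q of_real r = r *\<^sub>R x"
    and qinner_commute: "qinner x y = qcnj (qinner y x)"
    and qinner_left: "qinner (x \<cdot>\<^sub>q p + y \<cdot>\<^sub>q q) z = qinner x z * p + qinner y z * q"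
    and qinner_self: "qinner x x = of_real ((norm x)\<^sup>2)"

definition qsubspace :: "'a::quat_inner set \<Rightarrow> bool"
  where "qsubspace S \<longleftrightarrow>
    0 \<in> S \<and> (\<forall>x\<in>S. \<forall>y\<in>S. x + y \<in> S) \<and> (\<forall>x\<in>S. \<forall>q. x \<cdot>\<^sub>q q \<in> S)"

definition qspan :: "'a::quat_inner set \<Rightarrow> 'a set"
  where "qspan S = qsubspace hull S"

definition qindependent :: "'a::quat_inner set \<Rightarrow> bool"
  where "qindependent B \<longleftrightarrow> (\<forall>b\<in>B. b \<notin> qspan (B - {b}))"

text \<open>As for \<open>dim\<close> of the library, the value is 0 on infinite-dimensional subspaces.\<close>

definition qdim :: "'a::quat_inner set \<Rightarrow> nat"
  where "qdim V = (if \<exists>B. qindependent B \<and> qspan B = qspan V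
    then card (SOME B. qindependent B \<and> qspan B = qspan V) else 0)"


section \<open>Operators\<close>

definition Lr :: "('a::quat_inner \<Rightarrow> 'a) set"
  where "Lr = {T. bounded_linear T \<and> (\<forall>x q. T (x \<cdot>\<^sub>q q) = T x \<cdot>\<^sub>q q)}"

definition Lr_invertible :: "('a::quat_inner \<Rightarrow> 'a) \<Rightarrow> bool"
  where "Lr_invertible A \<longleftrightarrow> (\<exists>B\<in>Lr. A \<circ> B = id \<and> B \<circ> A = id)"

definition is_qadjoint :: "('a::quat_inner \<Rightarrow> 'a) \<Rightarrow> ('a \<Rightarrow> 'a) \<Rightarrow> bool"
  where "is_qadjoint A B \<longleftrightarrow> (\<forall>x y. qinner (A x) y = qinner x (B y))"

text \<open>\<open>V\<close> below is the adjoint \<open>U\<^sup>*\<close>, which is unique because the inner product is definite.\<close>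

definition quat_unitarily_equivalent ::
    "('a::quat_inner \<Rightarrow> 'a) \<Rightarrow> ('a \<Rightarrow> 'a) \<Rightarrow> bool"
  where "quat_unitarily_equivalent T1 T2 \<longleftrightarrow>
    (\<exists>U\<in>Lr. \<exists>V\<in>Lr. is_qadjoint U V \<and> V \<circ> U = id \<and> U \<circ> V = id \<and> U \<circ> T1 = T2 \<circ> U)"

text \<open>The operator \<open>T\<^sup>2 - 2 Re(s) T + |s|\<^sup>2 I\<close>.\<close>

definition qpoly :: "('a::quat_inner \<Rightarrow> 'a) \<Rightarrow> quat \<Rightarrow> 'a \<Rightarrow> 'a"
  where "qpoly T s x = T (T x) - (2 * qre s) *\<^sub>R T x + (norm s)\<^sup>2 *\<^sub>R x"

definition qker :: "('a::quat_inner \<Rightarrow> 'a) \<Rightarrow> 'a set"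
  where "qker A = {x. A x = 0}"

definition spherical_spectrum :: "('a::quat_inner \<Rightarrow> 'a) \<Rightarrow> quat set"
  where "spherical_spectrum T = {s. \<not> Lr_invertible (qpoly T s)}"

definition B1s :: "quat set \<Rightarrow> ('a::quat_inner \<Rightarrow> 'a) set"
  where "B1s \<Omega> = {T \<in> Lr.
    \<Omega> \<subseteq> spherical_spectrum T \<and>
    (\<forall>\<omega>\<in>\<Omega>. range (qpoly T \<omega>) = UNIV) \<and>
    closure (qspan (\<Union>\<omega>\<in>\<Omega>. qker (qpoly T \<omega>))) = UNIV \<and>
    (\<forall>\<omega>\<in>\<Omega>. qdim (qker (qpoly T \<omega>)) = 1)}"


section \<open>Right holomorphic frames and the canonical matrix representation\<close>

definition has_right_deriv :: "(complex \<Rightarrow> 'a::quat_inner) \<Rightarrow> 'a \<Rightarrow> complex \<Rightarrow> bool"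
  where "has_right_deriv \<gamma> D z \<longleftrightarrow>
    ((\<lambda>h. (\<gamma> (z + h) - \<gamma> z) \<cdot>\<^sub>q inverse (quat_of_complex h)) \<longlongrightarrow> D) (at 0)"

definition right_deriv :: "(complex \<Rightarrow> 'a::quat_inner) \<Rightarrow> complex \<Rightarrow> 'a"
  where "right_deriv \<gamma> z = (THE D. has_right_deriv \<gamma> D z)"

definition right_holomorphic_on :: "(complex \<Rightarrow> 'a::quat_inner) \<Rightarrow> complex set \<Rightarrow> bool"
  where "right_holomorphic_on \<gamma> S \<longleftrightarrow> (\<forall>z\<in>S. \<exists>D. has_right_deriv \<gamma> D z)"

definition right_holomorphic_frame ::
    "quat set \<Rightarrow> ('a::quat_inner \<Rightarrow> 'a) \<Rightarrow> complex set \<Rightarrow> (complex \<Rightarrow> 'a) \<Rightarrow> bool"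
  where "right_holomorphic_frame \<Omega> T \<Delta> \<gamma> \<longleftrightarrow>
    open \<Delta> \<and> \<Delta> \<subseteq> reduced \<Omega> \<and> right_holomorphic_on \<gamma> \<Delta> \<and>
    (\<forall>\<omega>\<in>\<Delta>. \<gamma> \<omega> \<noteq> 0 \<and> \<gamma> \<omega> \<in> qker (qpoly T (quat_of_complex \<omega>)))"

fun qgram_schmidt :: "(nat \<Rightarrow> 'a::quat_inner) \<Rightarrow> nat \<Rightarrow> 'a"
  where "qgram_schmidt f i =
    (let v = f i - (\<Sum>k<i. qgram_schmidt f k \<cdot>\<^sub>q qinner (f i) (qgram_schmidt f k))
     in v /\<^sub>R norm v)"

declare qgram_schmidt.simps [simp del]

definition canonical_matrix ::
    "quat set \<Rightarrow> ('a::quat_inner \<Rightarrow> 'a) \<Rightarrow> complex \<Rightarrow> (nat \<Rightarrow> nat \<Rightarrow> quat) \<Rightarrow> bool"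
  where "canonical_matrix \<Omega> T \<omega>\<^sub>0 N \<longleftrightarrow>
    (\<exists>\<Delta> \<gamma>. right_holomorphic_frame \<Omega> T \<Delta> \<gamma> \<and> \<omega>\<^sub>0 \<in> \<Delta> \<and>
      (let e = qgram_schmidt (\<lambda>i. (right_deriv ^^ i) \<gamma> \<omega>\<^sub>0)
       in N = (\<lambda>j k. qinner (T (e k)) (e j))))"

end

theory Submission
  imports Defs "HOL-Complex_Analysis.Complex_Analysis"
begin

text \<open>
  Everything is read off from the Taylor coefficients of a frame at one point.

  A right holomorphic frame \<open>\<gamma>\<close> automatically satisfies \<open>T \<gamma>(\<omega>) = \<gamma>(\<omega>) \<omega>\<close>: differentiating the kernel
  condition in the directions \<open>1\<close> and \<open>i\<close> excludes the eigenvalue \<open>cnj \<omega>\<close> (\<open>frame_eigenvector\<close>).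
  Differentiating this identity \<open>n\<close> times shows that \<open>a\<^sub>n = \<gamma>\<^sup>(\<^sup>n\<^sup>)(\<omega>) / n!\<close> is an infinite Jordan chain:
  \<open>x \<mapsto> T x - x \<omega>\<close> kills \<open>a\<^sub>0\<close> and maps \<open>a\<^sub>n\<^sub>+\<^sub>1\<close> to \<open>a\<^sub>n\<close> (\<open>frame_taylor_chain\<close>).  Three facts about such
  chains carry the proof.

  \<^item> The chain is unique up to a triangular change of basis with a constant complex diagonal \<open>c\<close>,
    because the eigenspace of \<open>\<omega>\<close> is a complex line (\<open>jordan_chain_unique\<close>).
  \<^item> The chain is independent over the quaternions, and its initial segments span \<open>T\<close>-invariant
    subspaces (\<open>jordan_chain_independent\<close>, \<open>jordan_chain_invariant\<close>).
  \<^item> The chain spans a dense subspace (\<open>jordan_chain_total\<close>).  Over a single point the power series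
    with coefficients \<open>a\<^sub>n\<close> yields the eigenvectors for all nearby points and conversely is determined
    by them; the open mapping theorem bounds the radii of convergence below, locally uniformly, so
    connectedness carries the inclusion of eigenspaces in the closed span over the whole domain,
    where they are total by assumption.

  Suppose that \<open>U\<close> is unitary and \<open>U T\<^sub>1 = T\<^sub>2 U\<close>.  Then \<open>U\<close> maps a chain of \<open>T\<^sub>1\<close> to a chain of \<open>T\<^sub>2\<close>, and
  uniqueness compares it with the given one.  Gram--Schmidt removes everything from the triangular
  change of basis except the phase of \<open>c\<close> (\<open>qgram_schmidt_triangular\<close>), so the two orthonormal bases
  correspond up to a common right factor \<open>exp (i \<theta>)\<close>, which conjugates the matrix.

  Conversely, when the matrices agree up to such a phase, the unitary that maps one orthonormal
  basis to the other, corrected by the phase, intertwines the operators on basis vectors.  Invariance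
  of the initial segments makes the columns of the matrices finite, so no convergence question arises.
\<close>

section \<open>Quaternions and the complex subfield\<close>

abbreviation qc :: "complex \<Rightarrow> quat"
  where "qc \<equiv> quat_of_complex"

lemma quat_of_real_sel [simp]:
  "qre (of_real r) = r" "qi (of_real r) = 0" "qj (of_real r) = 0" "qk (of_real r) = 0"
  by (simp_all add: of_real_def one_quat_def)

lemma quat_of_complex_sel [simp]:
  "qre (qc z) = Re z" "qi (qc z) = Im z" "qj (qc z) = 0" "qk (qc z) = 0"
  by (simp_all add: quat_of_complex_def)

lemma quat_one_sel [simp]: "qre 1 = 1" "qi 1 = 0" "qj 1 = 0" "qk 1 = 0"
  by (simp_all add: one_quat_def)

lemma quat_times_sel [simp]:
  "qre (p * q) = qre p * qre q - qi p * qi q - qj p * qj q - qk p * qk q"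
  "qi (p * q) = qre p * qi q + qi p * qre q + qj p * qk q - qk p * qj q"
  "qj (p * q) = qre p * qj q - qi p * qk q + qj p * qre q + qk p * qi q"
  "qk (p * q) = qre p * qk q + qi p * qj q - qj p * qi q + qk p * qre q"
  by (simp_all add: times_quat_def)

lemma quat_of_complex_simps [simp]:
  "qc 0 = 0" "qc 1 = 1" "qc (of_real r) = of_real r"
  "qc (- z) = - qc z"
  by (simp_all add: quat_eq_iff)

lemma quat_of_complex_add: "qc (z + w) = qc z + qc w"
  and quat_of_complex_diff: "qc (z - w) = qc z - qc w"
  and quat_of_complex_mult: "qc (z * w) = qc z * qc w"
  by (simp_all add: quat_eq_iff)

lemma norm_quat_of_complex [simp]: "norm (qc z) = norm z"
  by (rule power2_eq_imp_eq) (simp_all add: quat_norm_squared cmod_power2)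

lemma quat_of_complex_eq_0_iff [simp]: "qc z = 0 \<longleftrightarrow> z = 0"
  by (metis norm_eq_zero norm_quat_of_complex)

lemma quat_of_complex_inverse: "qc (inverse z) = inverse (qc z)"
proof (cases "z = 0")
  case False
  then have "qc z * qc (inverse z) = 1"
    by (simp flip: quat_of_complex_mult)
  then show ?thesis
    by (rule inverse_unique[symmetric])
qed simp

lemma qcnj_quat_of_complex [simp]: "qcnj (qc z) = qc (cnj z)"
  by (simp add: quat_eq_iff)

lemma qcnj_simps [simp]:
  "qcnj 0 = 0" "qcnj 1 = 1" "qcnj (of_real r) = of_real r" "qcnj (qcnj p) = p"
  by (simp_all add: quat_eq_iff)

lemma qcnj_add: "qcnj (p + q) = qcnj p + qcnj q"
  and qcnj_diff: "qcnj (p - q) = qcnj p - qcnj q"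
  and qcnj_mult: "qcnj (p * q) = qcnj q * qcnj p"
  by (simp_all add: quat_eq_iff algebra_simps)

lemma norm_qcnj [simp]: "norm (qcnj p) = norm p"
  by (rule power2_eq_imp_eq) (simp_all add: quat_norm_squared)

lemma qcnj_mult_self: "qcnj p * p = of_real ((norm p)\<^sup>2)" "p * qcnj p = of_real ((norm p)\<^sup>2)"
  by (simp_all add: quat_eq_iff quat_norm_squared) (simp_all add: power2_eq_square)

lemma quat_of_real_commute: "of_real r * p = p * (of_real r :: quat)"
  by (simp add: quat_eq_iff)

lemma scaleR_quat_conv: "r *\<^sub>R p = p * (of_real r :: quat)"
  by (simp add: quat_eq_iff)

text \<open>
  A non-real complex number has the complex numbers as its centraliser.  This is what makes an
  eigenspace inside a quaternionic line a complex line.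
\<close>

lemma quat_of_complex_commutes_imp_complex:
  assumes "qc z * p = p * qc z" and "Im z \<noteq> 0"
  shows "\<exists>c. p = qc c"
proof -
  have "qj p = 0" "qk p = 0"
    using assms by (auto simp: quat_eq_iff)
  then have "p = qc (Complex (qre p) (qi p))"
    by (simp add: quat_eq_iff)
  then show ?thesis ..
qed


section \<open>Right quaternionic inner product spaces\<close>

lemma qscale_one [simp]: "x \<cdot>\<^sub>q 1 = x"
  using qscale_of_real[of x 1] by simp

lemma qscale_zero_right [simp]: "x \<cdot>\<^sub>q 0 = 0"
  using qscale_of_real[of x 0] by simp

lemma qscale_zero_left [simp]: "0 \<cdot>\<^sub>q p = 0"
  using qscale_add_left[of 0 0 p] by simp

lemma qscale_minus_right: "x \<cdot>\<^sub>q (- p) = - (x \<cdot>\<^sub>q p)"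
  using qscale_add_right[of x p "- p"] by (simp add: eq_neg_iff_add_eq_0 add.commute)

lemma qscale_minus_left: "(- x) \<cdot>\<^sub>q p = - (x \<cdot>\<^sub>q p)"
  using qscale_add_left[of x "- x" p] by (simp add: eq_neg_iff_add_eq_0 add.commute)

lemma qscale_diff_left: "(x - y) \<cdot>\<^sub>q p = x \<cdot>\<^sub>q p - y \<cdot>\<^sub>q p"
  using qscale_add_left[of x "- y" p] by (simp add: qscale_minus_left)

lemma qscale_diff_right: "x \<cdot>\<^sub>q (p - q) = x \<cdot>\<^sub>q p - x \<cdot>\<^sub>q q"
  using qscale_add_right[of x p "- q"] by (simp add: qscale_minus_right)

lemma qscale_scaleR_right: "x \<cdot>\<^sub>q (r *\<^sub>R p) = r *\<^sub>R (x \<cdot>\<^sub>q p)"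
  using qscale_qscale[of x p "of_real r"] unfolding qscale_of_real
  by (simp add: of_real_def)

lemma qscale_scaleR_left: "(r *\<^sub>R x) \<cdot>\<^sub>q p = r *\<^sub>R (x \<cdot>\<^sub>q p)"
  using qscale_qscale[of x "of_real r" p] unfolding qscale_of_real
  by (simp add: of_real_def qscale_scaleR_right)

lemma qscale_sum_left: "(\<Sum>i\<in>A. f i) \<cdot>\<^sub>q p = (\<Sum>i\<in>A. f i \<cdot>\<^sub>q p)"
  by (induction A rule: infinite_finite_induct) (simp_all add: qscale_add_left)

lemma qscale_inverse_cancel [simp]:
  "p \<noteq> 0 \<Longrightarrow> (x \<cdot>\<^sub>q p) \<cdot>\<^sub>q inverse p = x" "p \<noteq> 0 \<Longrightarrow> (x \<cdot>\<^sub>q inverse p) \<cdot>\<^sub>q p = x"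
  by (simp_all add: qscale_qscale)

lemma qinner_add_left: "qinner (x + y) z = qinner x z + qinner y z"
  using qinner_left[of x 1 y 1 z] by simp

lemma qinner_qscale_left: "qinner (x \<cdot>\<^sub>q p) z = qinner x z * p"
  using qinner_left[of x p 0 0 z] by simp

lemma qinner_zero_left [simp]: "qinner 0 z = 0"
  using qinner_qscale_left[of 0 0 z] by simp

lemma qinner_minus_left: "qinner (- x) z = - qinner x z"
  using qinner_add_left[of x "- x" z] by (simp add: eq_neg_iff_add_eq_0 add.commute)

lemma qinner_diff_left: "qinner (x - y) z = qinner x z - qinner y z"
  using qinner_add_left[of x "- y" z] by (simp add: qinner_minus_left)

lemma qinner_scaleR_left: "qinner (r *\<^sub>R x) z = r *\<^sub>R qinner x z"
  using qinner_qscale_left[of x "of_real r" z] unfolding qscale_of_real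
  by (simp add: of_real_def)

lemma qinner_sum_left: "qinner (\<Sum>i\<in>A. f i) z = (\<Sum>i\<in>A. qinner (f i) z)"
  by (induction A rule: infinite_finite_induct) (simp_all add: qinner_add_left)

lemma qinner_zero_right [simp]: "qinner z 0 = 0"
  by (subst qinner_commute) simp

lemma qinner_add_right: "qinner z (x + y) = qinner z x + qinner z y"
  by (subst (1 2 3) qinner_commute) (simp add: qcnj_add qinner_add_left)

lemma qinner_diff_right: "qinner z (x - y) = qinner z x - qinner z y"
  by (subst (1 2 3) qinner_commute) (simp add: qcnj_diff qinner_diff_left)

lemma qinner_qscale_right: "qinner z (x \<cdot>\<^sub>q p) = qcnj p * qinner z x"
  by (subst (1 2) qinner_commute) (simp add: qcnj_mult qinner_qscale_left)

lemma qinner_scaleR_right: "qinner z (r *\<^sub>R x) = r *\<^sub>R qinner z x"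
  using qinner_qscale_right[of z x "of_real r"] unfolding qscale_of_real
  by (simp add: quat_eq_iff)

lemma qinner_sum_right: "qinner z (\<Sum>i\<in>A. f i) = (\<Sum>i\<in>A. qinner z (f i))"
  by (induction A rule: infinite_finite_induct) (simp_all add: qinner_add_right)

lemma qinner_eq_0_commute: "qinner x y = 0 \<longleftrightarrow> qinner y x = 0"
  by (metis qcnj_simps(1) qinner_commute)

lemma norm_qscale [simp]: "norm (x \<cdot>\<^sub>q p) = norm x * norm p"
proof (rule power2_eq_imp_eq)
  have "of_real ((norm (x \<cdot>\<^sub>q p))\<^sup>2) = qcnj p * of_real ((norm x)\<^sup>2) * p"
    by (simp only: qinner_self[symmetric] qinner_qscale_left qinner_qscale_right mult.assoc)
  also have "\<dots> = of_real ((norm x)\<^sup>2) * (qcnj p * p)"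
    by (simp only: mult.assoc[symmetric] quat_of_real_commute[of _ "qcnj p"])
  also have "\<dots> = of_real ((norm x * norm p)\<^sup>2)"
    by (simp only: qcnj_mult_self power_mult_distrib of_real_mult)
  finally show "(norm (x \<cdot>\<^sub>q p))\<^sup>2 = (norm x * norm p)\<^sup>2"
    by (simp only: of_real_eq_iff)
qed auto

lemma qscale_eq_0_iff [simp]: "x \<cdot>\<^sub>q p = 0 \<longleftrightarrow> x = 0 \<or> p = 0"
  by (metis mult_eq_0_iff norm_eq_zero norm_qscale)

lemma norm_qinner_le: "norm (qinner x y) \<le> norm x * norm y"
proof (cases "y = 0")
  case False
  then have ny: "norm y > 0"
    by simp
  define p where "p = qinner x y"
  \<comment> \<open>The residual of \<open>x\<close> after projecting it onto the line of \<open>y\<close>.\<close>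
  define w where "w = x - y \<cdot>\<^sub>q (p /\<^sub>R (norm y)\<^sup>2)"
  have wy: "qinner w y = 0"
  proof -
    have "qinner w y = p - of_real ((norm y)\<^sup>2) * (p * of_real (inverse ((norm y)\<^sup>2)))"
      by (simp only: w_def p_def qinner_diff_left qinner_qscale_left qinner_self scaleR_quat_conv)
    also have "\<dots> = 0"
      using ny by (simp add: quat_eq_iff del: of_real_power of_real_inverse)
    finally show ?thesis .
  qed
  have "of_real ((norm w)\<^sup>2) = qinner w (x - y \<cdot>\<^sub>q (p /\<^sub>R (norm y)\<^sup>2))"
    by (simp only: qinner_self[symmetric] w_def)
  also have "\<dots> = qinner w x"
    by (simp add: qinner_diff_right qinner_qscale_right wy)
  also have "\<dots> = of_real ((norm x)\<^sup>2) - qcnj p * (p * of_real (inverse ((norm y)\<^sup>2)))"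
    unfolding w_def p_def
    by (simp only: qinner_diff_left qinner_qscale_left qinner_self scaleR_quat_conv
        qinner_commute[of y x])
  also have "\<dots> = of_real ((norm x)\<^sup>2 - (norm p)\<^sup>2 / (norm y)\<^sup>2)"
    by (simp only: mult.assoc[symmetric] qcnj_mult_self of_real_diff divide_inverse of_real_mult)
  finally have "(norm w)\<^sup>2 = (norm x)\<^sup>2 - (norm p)\<^sup>2 / (norm y)\<^sup>2"
    by (simp only: of_real_eq_iff)
  then have "(norm p)\<^sup>2 / (norm y)\<^sup>2 \<le> (norm x)\<^sup>2"
    using zero_le_power2[of "norm w"] by linarith
  then have "(norm p)\<^sup>2 \<le> (norm x * norm y)\<^sup>2"
    using ny by (simp add: pos_divide_le_eq power_mult_distrib)
  then show ?thesis
    unfolding p_def by (rule power2_le_imp_le) simp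
qed simp

lemma bounded_bilinear_qinner: "bounded_bilinear (qinner :: 'a::quat_inner \<Rightarrow> 'a \<Rightarrow> quat)"
  by standard (auto simp: qinner_add_left qinner_add_right qinner_scaleR_left qinner_scaleR_right
      intro!: exI[of _ 1] norm_qinner_le)

lemma bounded_bilinear_qscale: "bounded_bilinear (qscale :: 'a::quat_inner \<Rightarrow> quat \<Rightarrow> 'a)"
  by standard (auto simp: qscale_add_left qscale_add_right qscale_scaleR_left qscale_scaleR_right
      intro!: exI[of _ 1])

lemmas tendsto_qscale [tendsto_intros] = bounded_bilinear.tendsto[OF bounded_bilinear_qscale]
lemmas tendsto_qinner [tendsto_intros] = bounded_bilinear.tendsto[OF bounded_bilinear_qinner]
lemmas bounded_linear_qscale = bounded_bilinear.bounded_linear_left[OF bounded_bilinear_qscale]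

lemma bounded_linear_quat_of_complex: "bounded_linear qc"
  by (rule bounded_linear_intro[where K = 1])
     (simp_all add: quat_eq_iff)

lemma qinner_self_unit: "norm x = 1 \<Longrightarrow> qinner x x = 1"
  by (simp add: qinner_self)


section \<open>Subspaces, spans and right linear operators\<close>

lemma Lr_linear:
  assumes "A \<in> Lr"
  shows "A (x + y) = A x + A y" "A (x - y) = A x - A y" "A 0 = 0"
    "A (r *\<^sub>R x) = r *\<^sub>R A x" "A (x \<cdot>\<^sub>q q) = A x \<cdot>\<^sub>q q" "A (sum f I) = (\<Sum>i\<in>I. A (f i))"
    "A (- x) = - A x"
  using assms linear_add[of A] linear_diff[of A] linear_0[of A] linear_scale[of A]
    linear_sum[of A] linear_neg[of A]
  by (auto simp: Lr_def bounded_linear.linear)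

lemma Lr_bounded_linear: "A \<in> Lr \<Longrightarrow> bounded_linear A"
  by (simp add: Lr_def)

lemma LrI:
  assumes "\<And>x y. A (x + y) = A x + A y" "\<And>x q. A (x \<cdot>\<^sub>q q) = A x \<cdot>\<^sub>q q"
    and "\<And>x. norm (A x) \<le> norm x * K"
  shows "A \<in> Lr"
proof -
  have "A (r *\<^sub>R x) = r *\<^sub>R A x" for r x
    by (metis assms(2) qscale_of_real)
  then show ?thesis
    using assms by (auto simp: Lr_def intro!: bounded_linear_intro)
qed

lemma Lr_comp: "A \<in> Lr \<Longrightarrow> B \<in> Lr \<Longrightarrow> A \<circ> B \<in> Lr"
  by (auto simp: Lr_def o_def intro: bounded_linear_compose)

lemma id_Lr: "id \<in> Lr"
  by (rule LrI[where K = 1]) auto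

lemma qsubspaceD:
  assumes "qsubspace W"
  shows "0 \<in> W" "x \<in> W \<Longrightarrow> y \<in> W \<Longrightarrow> x + y \<in> W" "x \<in> W \<Longrightarrow> x \<cdot>\<^sub>q q \<in> W"
    "x \<in> W \<Longrightarrow> - x \<in> W" "x \<in> W \<Longrightarrow> y \<in> W \<Longrightarrow> x - y \<in> W" "x \<in> W \<Longrightarrow> r *\<^sub>R x \<in> W"
proof -
  show *: "0 \<in> W" "x \<in> W \<Longrightarrow> y \<in> W \<Longrightarrow> x + y \<in> W" "x \<in> W \<Longrightarrow> x \<cdot>\<^sub>q q \<in> W" for x y q
    using assms by (auto simp: qsubspace_def)
  show neg: "- x \<in> W" if "x \<in> W" for x
    using *(3)[OF that, of "- 1"] by (simp add: qscale_minus_right)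
  show "x - y \<in> W" if "x \<in> W" "y \<in> W" for x y
    using *(2)[OF that(1) neg[OF that(2)]] by simp
  show "x \<in> W \<Longrightarrow> r *\<^sub>R x \<in> W"
    using *(3)[of x "of_real r"] by (simp only: qscale_of_real)
qed

lemma qsubspace_sum:
  assumes "qsubspace W" "\<And>i. i \<in> I \<Longrightarrow> f i \<in> W"
  shows "sum f I \<in> W"
  using assms(2)
  by (induction I rule: infinite_finite_induct) (auto simp: qsubspaceD[OF assms(1)])

lemma qsubspace_Inter: "(\<And>W. W \<in> F \<Longrightarrow> qsubspace W) \<Longrightarrow> qsubspace (\<Inter>F)"
  by (auto simp: qsubspace_def)

lemma qsubspace_qspan: "qsubspace (qspan S)"
  unfolding qspan_def by (rule hull_in) (rule qsubspace_Inter, auto)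

lemmas qspanD = qsubspaceD[OF qsubspace_qspan]

lemma qspan_superset: "S \<subseteq> qspan S"
  unfolding qspan_def by (rule hull_subset)

lemma qspan_base: "x \<in> S \<Longrightarrow> x \<in> qspan S"
  using qspan_superset by blast

lemma qspan_minimal: "S \<subseteq> W \<Longrightarrow> qsubspace W \<Longrightarrow> qspan S \<subseteq> W"
  unfolding qspan_def by (rule hull_minimal)

lemma qspan_mono: "S \<subseteq> S' \<Longrightarrow> qspan S \<subseteq> qspan S'"
  unfolding qspan_def by (rule hull_mono)

lemma qspan_qsubspace: "qsubspace W \<Longrightarrow> qspan W = W"
  using qspan_minimal[of W W] qspan_superset[of W] by auto

lemma qspan_empty: "qspan {} = {0}"
  using qspan_minimal[of "{}" "{0}"] qspanD(1)[of "{}"] by (auto simp: qsubspace_def)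

lemma qspan_singleton: "qspan {b} = range (qscale b)"
proof
  have "qsubspace (range (qscale b))"
    unfolding qsubspace_def
    by (auto simp: qscale_qscale simp flip: qscale_add_right intro: range_eqI[of _ _ 0])
  moreover have "b \<in> range (qscale b)"
    by (rule range_eqI[of _ _ 1]) simp
  ultimately show "qspan {b} \<subseteq> range (qscale b)"
    by (intro qspan_minimal) auto
  show "range (qscale b) \<subseteq> qspan {b}"
    using qspanD(3)[OF qspan_base, of b "{b}"] by auto
qed

lemma qsubspace_vimage:
  assumes "A \<in> Lr" "qsubspace W"
  shows "qsubspace {x. A x \<in> W}"
  using assms(2) by (simp add: qsubspace_def Lr_linear[OF assms(1)])

lemma qsubspace_equalizer:
  assumes "A \<in> Lr" "B \<in> Lr"
  shows "qsubspace {x. A x = B x}"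
  by (simp add: qsubspace_def Lr_linear[OF assms(1)] Lr_linear[OF assms(2)])

lemma qspan_image_subset:
  assumes "A \<in> Lr" "A ` S \<subseteq> qspan S'"
  shows "A ` qspan S \<subseteq> qspan S'"
  using qspan_minimal[OF _ qsubspace_vimage[OF assms(1) qsubspace_qspan], of S S'] assms(2)
  by auto

lemma qsubspace_closure:
  assumes "qsubspace W"
  shows "qsubspace (closure W)"
  unfolding qsubspace_def
proof (intro conjI ballI allI)
  show "0 \<in> closure W"
    using qsubspaceD(1)[OF assms] closure_subset by blast
next
  fix x y assume "x \<in> closure W" "y \<in> closure W"
  then obtain f g where "\<And>n. f n \<in> W" "f \<longlonglongrightarrow> x" "\<And>n. g n \<in> W" "g \<longlonglongrightarrow> y"
    by (metis closure_sequential)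
  then show "x + y \<in> closure W"
    unfolding closure_sequential
    by (intro exI[of _ "\<lambda>n. f n + g n"]) (auto intro: tendsto_add qsubspaceD[OF assms])
next
  fix x q assume "x \<in> closure W"
  then obtain f where "\<And>n. f n \<in> W" "f \<longlonglongrightarrow> x"
    by (metis closure_sequential)
  then show "x \<cdot>\<^sub>q q \<in> closure W"
    unfolding closure_sequential
    by (intro exI[of _ "\<lambda>n. f n \<cdot>\<^sub>q q"]) (auto intro!: tendsto_intros qsubspaceD[OF assms])
qed

lemma Lr_eq_on_dense:
  assumes "A \<in> Lr" "B \<in> Lr" "\<And>x. x \<in> S \<Longrightarrow> A x = B x" "closure (qspan S) = UNIV"
  shows "A = B"
proof -
  have "qspan S \<subseteq> {x. A x = B x}"
    using assms(3) by (intro qspan_minimal qsubspace_equalizer assms(1,2)) auto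
  moreover have "closed {x. A x = B x}"
    using assms(1,2)
    by (intro closed_Collect_eq linear_continuous_on Lr_bounded_linear)
  ultimately have "closure (qspan S) \<subseteq> {x. A x = B x}"
    by (rule closure_minimal)
  then show ?thesis
    using assms(4) by auto
qed


section \<open>Orthonormal sequences and Gram--Schmidt\<close>

definition qproj :: "(nat \<Rightarrow> 'a::quat_inner) \<Rightarrow> nat \<Rightarrow> 'a \<Rightarrow> 'a"
  where "qproj e n x = (\<Sum>k<n. e k \<cdot>\<^sub>q qinner x (e k))"

text \<open>
  Zero vectors are admitted because Gram--Schmidt returns one whenever its input is dependent;
  allowing them lets the equivariance of Gram--Schmidt be proved before independence is known.
\<close>

definition qorthogonal_units :: "(nat \<Rightarrow> 'a::quat_inner) \<Rightarrow> bool"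
  where "qorthogonal_units e \<longleftrightarrow>
    (\<forall>i j. i \<noteq> j \<longrightarrow> qinner (e i) (e j) = 0) \<and> (\<forall>i. e i = 0 \<or> norm (e i) = 1)"

lemma qproj_in_qspan: "qproj e n x \<in> qspan (e ` {..<n})"
  unfolding qproj_def by (intro qsubspace_sum qsubspace_qspan qspanD(3) qspan_base) auto

lemma qproj_Lr_like:
  "qproj e n (x + y) = qproj e n x + qproj e n y"
  "qproj e n (x - y) = qproj e n x - qproj e n y"
  "qproj e n (x \<cdot>\<^sub>q q) = qproj e n x \<cdot>\<^sub>q q"
  by (simp_all add: qproj_def qinner_add_left qinner_diff_left qinner_qscale_left qscale_add_right
      qscale_diff_right qscale_sum_left qscale_qscale sum.distrib sum_subtractf)

lemma unit_or_zero_scale: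
  assumes "x = 0 \<or> norm x = 1"
  shows "x \<cdot>\<^sub>q qinner x x = x" "qinner x x * qinner y x = qinner y x"
  using assms by (auto simp: qinner_self_unit)

lemma qproj_residual_orthogonal:
  assumes "\<And>j. j < n \<Longrightarrow> j \<noteq> i \<Longrightarrow> qinner (e j) (e i) = 0" "e i = 0 \<or> norm (e i) = 1" "i < n"
  shows "qinner (x - qproj e n x) (e i) = 0"
proof -
  have "qinner (qproj e n x) (e i) = (\<Sum>k<n. qinner (e k) (e i) * qinner x (e k))"
    by (simp add: qproj_def qinner_sum_left qinner_qscale_left)
  also have "\<dots> = (\<Sum>k<n. if k = i then qinner x (e i) else 0)"
    using assms(1) unit_or_zero_scale(2)[OF assms(2)] by (intro sum.cong) auto
  also have "\<dots> = qinner x (e i)"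
    using assms(3) by simp
  finally show ?thesis
    by (simp add: qinner_diff_left)
qed

lemma qproj_on_qspan:
  assumes "qorthogonal_units e" "y \<in> qspan (e ` {..<n})"
  shows "qproj e n y = y"
proof -
  have "qproj e n (e i) = e i" if "i < n" for i
  proof -
    have "qproj e n (e i) = (\<Sum>k<n. if k = i then e i else 0)"
      unfolding qproj_def using assms(1) unit_or_zero_scale(1)[of "e i"]
      by (intro sum.cong) (auto simp: qorthogonal_units_def)
    then show ?thesis
      using that by simp
  qed
  moreover have "qsubspace {y. qproj e n y = y}"
    by (auto simp: qsubspace_def qproj_Lr_like) (simp add: qproj_def)
  ultimately have "qspan (e ` {..<n}) \<subseteq> {y. qproj e n y = y}"
    by (intro qspan_minimal) auto
  then show ?thesis
    using assms(2) by auto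
qed

lemma qgram_schmidt_residual:
  "qgram_schmidt f n = (f n - qproj (qgram_schmidt f) n (f n)) /\<^sub>R
     norm (f n - qproj (qgram_schmidt f) n (f n))"
  by (subst qgram_schmidt.simps) (simp add: qproj_def Let_def)

lemma qgram_schmidt_zero_or_unit: "qgram_schmidt f n = 0 \<or> norm (qgram_schmidt f n) = 1"
  unfolding qgram_schmidt_residual[of f n]
  by (cases "f n = qproj (qgram_schmidt f) n (f n)") auto

lemma qgram_schmidt_orthogonal_less: "i < j \<Longrightarrow> qinner (qgram_schmidt f j) (qgram_schmidt f i) = 0"
proof (induction j arbitrary: i rule: less_induct)
  case (less j)
  let ?e = "qgram_schmidt f"
  have "qinner (f j - qproj ?e j (f j)) (?e i) = 0"
  proof (rule qproj_residual_orthogonal)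
    show "qinner (?e k) (?e i) = 0" if "k < j" "k \<noteq> i" for k
      using that less.IH[of k i] less.IH[of i k] less.prems qinner_eq_0_commute[of "?e k" "?e i"]
      by (cases "i < k") auto
  qed (use less.prems qgram_schmidt_zero_or_unit in auto)
  then show ?case
    by (subst qgram_schmidt_residual) (simp add: qinner_scaleR_left)
qed

lemma qgram_schmidt_orthogonal_units: "qorthogonal_units (qgram_schmidt f)"
  unfolding qorthogonal_units_def
  using qgram_schmidt_orthogonal_less qgram_schmidt_zero_or_unit
  by (metis linorder_neqE_nat qinner_eq_0_commute)

lemma qgram_schmidt_reconstruct:
  "f n = norm (f n - qproj (qgram_schmidt f) n (f n)) *\<^sub>R qgram_schmidt f n
     + qproj (qgram_schmidt f) n (f n)"
  unfolding qgram_schmidt_residual[of f n] by (cases "f n = qproj (qgram_schmidt f) n (f n)") auto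

lemma qspan_qgram_schmidt: "qspan (qgram_schmidt f ` {..<n}) = qspan (f ` {..<n})"
proof (induction n)
  case (Suc n)
  let ?e = "qgram_schmidt f"
  let ?E = "qspan (?e ` {..<Suc n})" and ?F = "qspan (f ` {..<Suc n})"
  have sub: "qspan (?e ` {..<n}) \<subseteq> ?E" "qspan (?e ` {..<n}) \<subseteq> ?F"
    using qspan_mono[of "?e ` {..<n}" "?e ` {..<Suc n}"] qspan_mono[of "f ` {..<n}" "f ` {..<Suc n}"]
    unfolding Suc.IH by (simp_all add: image_mono)
  have proj: "qproj ?e n (f n) \<in> qspan (?e ` {..<n})"
    by (rule qproj_in_qspan)
  have "f n \<in> ?F" "?e n \<in> ?E"
    by (auto intro: qspan_base)
  then have "?e n \<in> ?F"
    using proj sub(2) by (subst qgram_schmidt_residual) (auto intro!: qspanD)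
  have "f n \<in> ?E"
    using proj sub(1) \<open>?e n \<in> ?E\<close> by (subst qgram_schmidt_reconstruct) (auto intro!: qspanD)
  have "?e ` {..<Suc n} \<subseteq> ?F"
    using \<open>?e n \<in> ?F\<close> order_trans[OF qspan_superset sub(2)]
    unfolding image_subset_iff by (auto simp: less_Suc_eq)
  moreover have "f ` {..<Suc n} \<subseteq> ?E"
    using \<open>f n \<in> ?E\<close> order_trans[OF qspan_superset sub(1)[unfolded Suc.IH]]
    unfolding image_subset_iff by (auto simp: less_Suc_eq)
  ultimately show ?case
    by (intro subset_antisym qspan_minimal qsubspace_qspan)
qed simp

text \<open>
  Gram--Schmidt only sees the flag of spans of initial segments and the direction in which each
  new vector leaves the previous span.  A positive factor \<open>r\<close> is removed by the normalisation and
  a common unit quaternion \<open>c\<close> on the right survives, since the projections \<open>e\<^sub>k\<langle>x, e\<^sub>k\<rangle>\<close> do not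
  change when every \<open>e\<^sub>k\<close> is multiplied by \<open>c\<close>.
\<close>

lemma qgram_schmidt_triangular:
  assumes c: "norm c = 1"
    and step: "\<And>n. \<exists>r>0. g n - f n \<cdot>\<^sub>q (r *\<^sub>R c) \<in> qspan (f ` {..<n})"
  shows "qgram_schmidt g n = qgram_schmidt f n \<cdot>\<^sub>q c"
proof (induction n rule: less_induct)
  case (less n)
  let ?e = "qgram_schmidt f"
  have cc: "c * (qcnj c * q) = q" for q
    using qcnj_mult_self(2)[of c] c by (simp flip: mult.assoc)
  have same: "qproj (qgram_schmidt g) n x = qproj ?e n x" for x
    unfolding qproj_def using less.IH
    by (intro sum.cong) (simp_all add: qinner_qscale_right qscale_qscale cc)
  obtain r where r: "r > 0" and s: "g n - f n \<cdot>\<^sub>q (r *\<^sub>R c) \<in> qspan (f ` {..<n})"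
    using step by blast
  define d where "d = g n - f n \<cdot>\<^sub>q (r *\<^sub>R c)"
  have "qproj ?e n d = d"
    using s qproj_on_qspan[OF qgram_schmidt_orthogonal_units, of d f n]
    by (simp add: d_def qspan_qgram_schmidt)
  moreover have "g n = f n \<cdot>\<^sub>q (r *\<^sub>R c) + d"
    by (simp add: d_def)
  ultimately have "g n - qproj ?e n (g n) = (f n - qproj ?e n (f n)) \<cdot>\<^sub>q (r *\<^sub>R c)"
    by (simp add: qproj_Lr_like qscale_diff_left)
  then show ?case
    using r c
    by (subst (1 2) qgram_schmidt_residual)
       (simp add: same qscale_scaleR_right qscale_scaleR_left)
qed

definition qorthonormal :: "(nat \<Rightarrow> 'a::quat_inner) \<Rightarrow> bool"
  where "qorthonormal e \<longleftrightarrow> (\<forall>i j. qinner (e i) (e j) = (if i = j then 1 else 0))"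

lemma qorthonormal_imp_units:
  assumes "qorthonormal e"
  shows "qorthogonal_units e"
proof -
  have "norm (e i) = 1" for i
  proof -
    have "qinner (e i) (e i) = 1"
      using assms by (simp add: qorthonormal_def)
    then have "norm (qinner (e i) (e i)) = 1"
      by simp
    then show ?thesis
      by (simp add: qinner_self power2_eq_1_iff norm_power) (metis norm_ge_zero not_one_le_zero neg_0_le_iff_le)
  qed
  then show ?thesis
    using assms by (auto simp: qorthonormal_def qorthogonal_units_def)
qed

lemma qorthonormal_qgram_schmidt:
  assumes "\<And>n. f n \<notin> qspan (f ` {..<n})"
  shows "qorthonormal (qgram_schmidt f)"
proof -
  have "qgram_schmidt f n \<noteq> 0" for n
  proof
    assume "qgram_schmidt f n = 0"
    then have "f n = qproj (qgram_schmidt f) n (f n)"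
      by (subst qgram_schmidt_reconstruct) simp
    then have "f n \<in> qspan (qgram_schmidt f ` {..<n})"
      using qproj_in_qspan[of "qgram_schmidt f"] by metis
    then show False
      using assms by (simp add: qspan_qgram_schmidt)
  qed
  then show ?thesis
    using qgram_schmidt_orthogonal_units[of f]
    by (auto simp: qorthogonal_units_def qorthonormal_def intro: qinner_self_unit)
qed

lemma qspan_range_UN: "qspan (range e) = (\<Union>n. qspan (e ` {..<n::nat}))"
proof
  have mono: "qspan (e ` {..<m}) \<subseteq> qspan (e ` {..<n})" if "m \<le> n" for m n
    using that by (intro qspan_mono image_mono) auto
  have "qsubspace (\<Union>n. qspan (e ` {..<n}))"
    unfolding qsubspace_def
  proof (intro conjI ballI allI)
    fix x y assume "x \<in> (\<Union>n. qspan (e ` {..<n}))" "y \<in> (\<Union>n. qspan (e ` {..<n}))"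
    then obtain m n where "x \<in> qspan (e ` {..<m})" "y \<in> qspan (e ` {..<n})"
      by auto
    then have "x \<in> qspan (e ` {..<max m n})" "y \<in> qspan (e ` {..<max m n})"
      using mono[of m "max m n"] mono[of n "max m n"] by auto
    then show "x + y \<in> (\<Union>n. qspan (e ` {..<n}))"
      using qspanD(2) by blast
  qed (auto intro: qspanD)
  moreover have "range e \<subseteq> (\<Union>n. qspan (e ` {..<n}))"
  proof
    fix x assume "x \<in> range e"
    then obtain k where "x = e k" by auto
    then have "x \<in> qspan (e ` {..<Suc k})"
      by (auto intro: qspan_base)
    then show "x \<in> (\<Union>n. qspan (e ` {..<n}))"
      by blast
  qed
  ultimately show "qspan (range e) \<subseteq> (\<Union>n. qspan (e ` {..<n}))"
    by (rule qspan_minimal[rotated])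
  show "(\<Union>n. qspan (e ` {..<n})) \<subseteq> qspan (range e)"
    by (intro UN_least qspan_mono) auto
qed

lemma qproj_best_approximation:
  assumes e: "qorthogonal_units e" and y: "y \<in> qspan (e ` {..<n})"
  shows "norm (x - qproj e n x) \<le> norm (x - y)"
proof -
  define r where "r = x - qproj e n x"
  have "qinner (e i) r = 0" if "i < n" for i
    using qproj_residual_orthogonal[of n i e x] e that qinner_eq_0_commute[of r "e i"]
    unfolding r_def qorthogonal_units_def by blast
  moreover have "qsubspace {w. qinner w r = 0}"
    by (auto simp: qsubspace_def qinner_add_left qinner_qscale_left)
  ultimately have "qspan (e ` {..<n}) \<subseteq> {w. qinner w r = 0}"
    by (intro qspan_minimal) auto
  then have "qinner (qproj e n x) r = 0" "qinner y r = 0"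
    using y qproj_in_qspan by auto
  then have "qinner r r = qinner (x - y) r"
    by (subst r_def) (simp add: qinner_diff_left)
  then have "norm (qinner r r) \<le> norm (x - y) * norm r"
    using norm_qinner_le[of "x - y" r] by simp
  then have "norm r * norm r \<le> norm (x - y) * norm r"
    by (simp add: qinner_self norm_power power2_eq_square norm_mult)
  then show ?thesis
    unfolding r_def[symmetric] by (cases "r = 0") auto
qed

lemma qproj_tendsto:
  assumes e: "qorthogonal_units e" and dense: "closure (qspan (range e)) = UNIV"
  shows "(\<lambda>n. qproj e n x) \<longlonglongrightarrow> x"
proof (rule metric_LIMSEQ_I)
  fix \<epsilon> :: real assume "\<epsilon> > 0"
  then obtain y where y: "y \<in> qspan (range e)" "dist y x < \<epsilon>"
    using dense closure_approachable[of x "qspan (range e)"] by auto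
  then obtain N where N: "y \<in> qspan (e ` {..<N})"
    using qspan_range_UN[of e] by auto
  have "dist (qproj e n x) x < \<epsilon>" if "n \<ge> N" for n
  proof -
    have "qspan (e ` {..<N}) \<subseteq> qspan (e ` {..<n})"
      using that by (intro qspan_mono image_mono) auto
    then have "norm (x - qproj e n x) \<le> norm (x - y)"
      using N by (intro qproj_best_approximation[OF e]) auto
    then show ?thesis
      using y(2) by (simp add: dist_norm norm_minus_commute)
  qed
  then show "\<exists>N. \<forall>n\<ge>N. dist (qproj e n x) x < \<epsilon>"
    by blast
qed

lemma norm_sum_orthonormal:
  assumes "qorthonormal e" "finite I"
  shows "(norm (\<Sum>k\<in>I. e k \<cdot>\<^sub>q q k))\<^sup>2 = (\<Sum>k\<in>I. (norm (q k))\<^sup>2)"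
proof -
  have "qinner (\<Sum>k\<in>I. e k \<cdot>\<^sub>q q k) (\<Sum>k\<in>I. e k \<cdot>\<^sub>q q k)
      = (\<Sum>k\<in>I. \<Sum>j\<in>I. qcnj (q k) * qinner (e j) (e k) * q j)"
    by (simp add: qinner_sum_right qinner_sum_left qinner_qscale_right qinner_qscale_left
        sum_distrib_left mult.assoc)
  also have "\<dots> = (\<Sum>k\<in>I. \<Sum>j\<in>I. if j = k then qcnj (q k) * q k else 0)"
    using assms(1) by (intro sum.cong refl) (auto simp: qorthonormal_def)
  also have "\<dots> = (\<Sum>k\<in>I. of_real ((norm (q k))\<^sup>2))"
    using assms(2) by (simp add: qcnj_mult_self del: of_real_power)
  finally show ?thesis
    by (simp only: qinner_self of_real_sum[symmetric] of_real_eq_iff)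
qed

text \<open>
  The isometry is \<open>x \<mapsto> \<Sum> e'\<^sub>k\<langle>x, e\<^sub>k\<rangle>\<close>.  Blocks of this series have the same norm as those of
  \<open>\<Sum> e\<^sub>k\<langle>x, e\<^sub>k\<rangle>\<close>, which converges to \<open>x\<close>; so the partial sums are Cauchy.
\<close>

lemma isometry_between_orthonormal_bases:
  fixes e e' :: "nat \<Rightarrow> 'a::{quat_inner, complete_space}"
  assumes e: "qorthonormal e" and e': "qorthonormal e'"
    and dense: "closure (qspan (range e)) = UNIV"
  obtains U where "U \<in> Lr" "\<And>k. U (e k) = e' k" "\<And>x y. qinner (U x) (U y) = qinner x y"
proof -
  define P where "P n x = (\<Sum>k<n. e' k \<cdot>\<^sub>q qinner x (e k))" for n x
  define U where "U x = lim (\<lambda>n. P n x)" for x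
  have to_x: "(\<lambda>n. qproj e n x) \<longlonglongrightarrow> x" for x
    using qproj_tendsto[OF qorthonormal_imp_units[OF e] dense] .
  have inner_P: "qinner (P n x) (P n y) = qinner (qproj e n x) (qproj e n y)" for n x y
    using e e' by (simp add: P_def qproj_def qinner_sum_right qinner_sum_left qinner_qscale_right
        qinner_qscale_left qorthonormal_def)
  have norm_P: "norm (P m x - P n x) = norm (qproj e m x - qproj e n x)" if "n \<le> m" for m n x
  proof -
    have split: "{..<m} = {..<n} \<union> {n..<m}" "{..<n} \<inter> {n..<m} = {}"
      using that by auto
    have "P m x - P n x = (\<Sum>k\<in>{n..<m}. e' k \<cdot>\<^sub>q qinner x (e k))"
      "qproj e m x - qproj e n x = (\<Sum>k\<in>{n..<m}. e k \<cdot>\<^sub>q qinner x (e k))"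
      unfolding P_def qproj_def split(1) using split(2) by (simp_all add: sum.union_disjoint)
    then have "(norm (P m x - P n x))\<^sup>2 = (norm (qproj e m x - qproj e n x))\<^sup>2"
      by (simp add: norm_sum_orthonormal[OF e] norm_sum_orthonormal[OF e'])
    then show ?thesis
      by simp
  qed
  have U: "(\<lambda>n. P n x) \<longlonglongrightarrow> U x" for x
  proof -
    have "Cauchy (\<lambda>n. qproj e n x)"
      using to_x LIMSEQ_imp_Cauchy by blast
    then have "Cauchy (\<lambda>n. P n x)"
      unfolding Cauchy_altdef dist_norm
      by (metis norm_P norm_minus_commute less_imp_le)
    then show ?thesis
      unfolding U_def by (simp add: Cauchy_convergent convergent_LIMSEQ_iff[symmetric])
  qed
  have inner_U: "qinner (U x) (U y) = qinner x y" for x y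
  proof (rule LIMSEQ_unique)
    show "(\<lambda>n. qinner (P n x) (P n y)) \<longlonglongrightarrow> qinner (U x) (U y)"
      by (intro tendsto_intros U)
    show "(\<lambda>n. qinner (P n x) (P n y)) \<longlonglongrightarrow> qinner x y"
      unfolding inner_P by (intro tendsto_intros to_x)
  qed
  have "U \<in> Lr"
  proof (rule LrI)
    show "U (x + y) = U x + U y" for x y
    proof (rule LIMSEQ_unique[OF U])
      have "P n (x + y) = P n x + P n y" for n
        by (simp add: P_def qinner_add_left qscale_add_right sum.distrib)
      then show "(\<lambda>n. P n (x + y)) \<longlonglongrightarrow> U x + U y"
        using tendsto_add[OF U U] by simp
    qed
    show "U (x \<cdot>\<^sub>q q) = U x \<cdot>\<^sub>q q" for x q
    proof (rule LIMSEQ_unique[OF U])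
      have "P n (x \<cdot>\<^sub>q q) = P n x \<cdot>\<^sub>q q" for n
        by (simp add: P_def qinner_qscale_left qscale_sum_left qscale_qscale)
      then show "(\<lambda>n. P n (x \<cdot>\<^sub>q q)) \<longlonglongrightarrow> U x \<cdot>\<^sub>q q"
        using tendsto_qscale[OF U tendsto_const] by simp
    qed
    have "(norm (U x))\<^sup>2 = (norm x)\<^sup>2" for x
      using inner_U[of x x] by (simp only: qinner_self of_real_eq_iff)
    then show "norm (U x) \<le> norm x * 1" for x
      by simp
  qed
  moreover have "U (e k) = e' k" for k
  proof (rule LIMSEQ_unique[OF U], rule tendsto_eventually, rule eventually_sequentiallyI)
    fix n assume "Suc k \<le> n"
    have "P n (e k) = (\<Sum>j<n. if j = k then e' k else 0)"
      unfolding P_def using e by (intro sum.cong) (auto simp: qorthonormal_def)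
    then show "P n (e k) = e' k"
      using \<open>Suc k \<le> n\<close> by simp
  qed
  ultimately show ?thesis
    using that inner_U by blast
qed

lemma unitary_between_orthonormal_bases:
  fixes e e' :: "nat \<Rightarrow> 'a::{quat_inner, complete_space}"
  assumes e: "qorthonormal e" "closure (qspan (range e)) = UNIV"
    and e': "qorthonormal e'" "closure (qspan (range e')) = UNIV"
  obtains U V where "U \<in> Lr" "V \<in> Lr" "is_qadjoint U V" "V \<circ> U = id" "U \<circ> V = id"
    "\<And>k. U (e k) = e' k"
proof -
  obtain U where U: "U \<in> Lr" "\<And>k. U (e k) = e' k" "\<And>x y. qinner (U x) (U y) = qinner x y"
    using isometry_between_orthonormal_bases[OF e(1) e'(1) e(2)] by metis
  obtain V where V: "V \<in> Lr" "\<And>k. V (e' k) = e k"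
    using isometry_between_orthonormal_bases[OF e'(1) e(1) e'(2)] by metis
  have VU: "V \<circ> U = id"
    by (rule Lr_eq_on_dense[OF Lr_comp[OF V(1) U(1)] id_Lr _ e(2)]) (auto simp: U V)
  have UV: "U \<circ> V = id"
    by (rule Lr_eq_on_dense[OF Lr_comp[OF U(1) V(1)] id_Lr _ e'(2)]) (auto simp: U V)
  have "is_qadjoint U V"
    unfolding is_qadjoint_def by (metis UV U(3) comp_apply id_apply)
  with U V VU UV that show ?thesis
    by blast
qed


section \<open>The reduced set\<close>

lemma qvec_eq: "qvec w = w - of_real (qre w)"
  by (simp add: qvec_def quat_eq_iff)

lemma qre_eq_inner: "qre w = inner w 1"
  by (simp add: inner_quat_def)

lemma norm_qvec_squared: "(norm (qvec w))\<^sup>2 = (norm w)\<^sup>2 - (qre w)\<^sup>2"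
  by (simp add: quat_norm_squared qvec_def)

lemma norm_reduced: "cmod (Complex (qre w) (norm (qvec w))) = norm w"
  by (rule power2_eq_imp_eq) (simp_all add: cmod_power2 norm_qvec_squared)

text \<open>
  Axial symmetry makes the reduced set the upper half of the slice of \<open>\<Omega>\<close> by the complex plane, which
  gives its openness; connectedness comes from the description as a continuous image.
\<close>

lemma reduced_iff:
  assumes "axially_symmetric \<Omega>" "\<Omega> \<inter> \<real> = {}"
  shows "z \<in> reduced \<Omega> \<longleftrightarrow> Im z > 0 \<and> qc z \<in> \<Omega>"
proof
  assume "z \<in> reduced \<Omega>"
  then obtain w where w: "w \<in> \<Omega>" "z = Complex (qre w) (norm (qvec w))"
    by (auto simp: reduced_def)
  have "qsim (qc z) w"
    using w(2) norm_reduced[of w] by (simp add: qsim_def)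
  then have "qc z \<in> \<Omega>"
    using assms(1) w(1) by (auto simp: axially_symmetric_def)
  moreover have "qvec w \<noteq> 0"
  proof
    assume "qvec w = 0"
    then have "w = of_real (qre w)"
      by (simp add: qvec_eq)
    then have "w \<in> \<real>"
      by (metis Reals_of_real)
    then show False
      using assms(2) w(1) by blast
  qed
  ultimately show "Im z > 0 \<and> qc z \<in> \<Omega>"
    using w(2) by simp
next
  assume *: "Im z > 0 \<and> qc z \<in> \<Omega>"
  have "norm (qvec (qc z)) = Im z"
    by (rule power2_eq_imp_eq) (use * in \<open>simp_all add: norm_qvec_squared cmod_power2\<close>)
  then have "z = Complex (qre (qc z)) (norm (qvec (qc z)))"
    by (simp add: complex_eq_iff)
  then show "z \<in> reduced \<Omega>"
    using * unfolding reduced_def by blast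
qed

lemma open_reduced:
  assumes "axially_symmetric \<Omega>" "\<Omega> \<inter> \<real> = {}" "open \<Omega>"
  shows "open (reduced \<Omega>)"
proof -
  have "continuous_on UNIV qc"
    by (intro linear_continuous_on bounded_linear_quat_of_complex)
  then have "open (qc -` \<Omega>)"
    using assms(3) by (simp add: continuous_on_open_vimage)
  moreover have "reduced \<Omega> = {z. Im z > 0} \<inter> qc -` \<Omega>"
    using reduced_iff[OF assms(1,2)] by auto
  ultimately show ?thesis
    by (simp add: open_Int open_halfspace_Im_gt)
qed

lemma connected_reduced:
  assumes "connected \<Omega>"
  shows "connected (reduced \<Omega>)"
  unfolding reduced_def Complex_eq qvec_eq qre_eq_inner
  by (intro connected_continuous_image assms continuous_intros)


section \<open>Eigenspaces inside the kernel of a sphere\<close>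

lemma qpoly_Lr:
  assumes "T \<in> Lr"
  shows "qpoly T s \<in> Lr"
proof -
  have "bounded_linear (qpoly T s)"
    unfolding qpoly_def[abs_def]
    by (intro bounded_linear_add bounded_linear_sub bounded_linear_scaleR_right[THEN bounded_linear_compose]
        Lr_bounded_linear[OF assms] bounded_linear_ident
        bounded_linear_compose[OF Lr_bounded_linear[OF assms]])
  then show ?thesis
    by (simp add: Lr_def qpoly_def Lr_linear[OF assms] qscale_diff_left qscale_add_left
        qscale_scaleR_left)
qed

lemma qker_qsubspace: "A \<in> Lr \<Longrightarrow> qsubspace (qker A)"
  by (simp add: qker_def qsubspace_def Lr_linear)

lemma qker_one_dimensional:
  assumes "A \<in> Lr" "qdim (qker A) = 1"
  obtains b where "b \<noteq> 0" "qker A = range (qscale b)"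
proof -
  let ?P = "\<lambda>B. qindependent B \<and> qspan B = qspan (qker A)"
  have ex: "\<exists>B. ?P B"
    using assms(2) by (auto simp: qdim_def split: if_splits)
  then have B: "?P (SOME B. ?P B)"
    by (rule someI_ex)
  have "card (SOME B. ?P B) = 1"
    using assms(2) ex by (simp add: qdim_def)
  then obtain b where "(SOME B. ?P B) = {b}"
    by (auto simp: card_1_singleton_iff)
  then have "qindependent {b}" "qspan {b} = qker A"
    using B qspan_qsubspace[OF qker_qsubspace[OF assms(1)]] by auto
  then show ?thesis
    using that[of b] by (auto simp: qindependent_def qspan_empty qspan_singleton)
qed

text \<open>
  The operator \<open>T - z\<close> with \<open>z\<close> acting on the right.  For non-real \<open>z\<close> it is linear over the complex
  numbers only, and so is not a member of \<open>Lr\<close>.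
\<close>

definition eigshift :: "('a::quat_inner \<Rightarrow> 'a) \<Rightarrow> complex \<Rightarrow> 'a \<Rightarrow> 'a"
  where "eigshift T z x = T x - x \<cdot>\<^sub>q qc z"

lemma eigshift_eq_0_iff: "eigshift T z x = 0 \<longleftrightarrow> T x = x \<cdot>\<^sub>q qc z"
  by (simp add: eigshift_def)

lemma quat_of_complex_commute: "qc z * qc w = qc w * qc z"
  by (simp flip: quat_of_complex_mult add: mult.commute)

lemma eigshift_linear:
  assumes "T \<in> Lr"
  shows "eigshift T z (x + y) = eigshift T z x + eigshift T z y"
    "eigshift T z (x - y) = eigshift T z x - eigshift T z y"
    "eigshift T z (x \<cdot>\<^sub>q qc c) = eigshift T z x \<cdot>\<^sub>q qc c"
    "eigshift T z 0 = 0"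
    "eigshift T z (sum f I) = (\<Sum>i\<in>I. eigshift T z (f i))"
  by (simp_all add: eigshift_def Lr_linear[OF assms] qscale_add_left qscale_diff_left qscale_qscale
      quat_of_complex_commute qscale_sum_left sum_subtractf)

lemma bounded_linear_eigshift: "T \<in> Lr \<Longrightarrow> bounded_linear (eigshift T z)"
  unfolding eigshift_def[abs_def]
  by (intro bounded_linear_sub Lr_bounded_linear bounded_linear_qscale)

text \<open>
  The factorisation \<open>T\<^sup>2 - 2 Re(z) T + |z|\<^sup>2 = (T - z)(T - cnj z)\<close> survives the noncommutativity because
  all right factors lie in the commutative subfield of complex numbers.
\<close>

lemma qpoly_eq_eigshift:
  assumes "T \<in> Lr"
  shows "qpoly T (qc z) x = eigshift T z (eigshift T (cnj z) x)"
    "qpoly T (qc z) x = eigshift T (cnj z) (eigshift T z x)"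
proof -
  have "of_real (2 * Re z) = qc z + qc (cnj z)"
    by (simp add: quat_eq_iff del: of_real_mult)
  then have "(2 * Re z) *\<^sub>R T x = T x \<cdot>\<^sub>q qc z + T x \<cdot>\<^sub>q qc (cnj z)"
    by (metis qscale_of_real qscale_add_right)
  moreover have "(cmod z)\<^sup>2 *\<^sub>R x = x \<cdot>\<^sub>q (qc z * qc (cnj z))"
    unfolding quat_of_complex_mult[symmetric] complex_norm_square[symmetric]
    by (simp only: quat_of_complex_simps qscale_of_real)
  ultimately show "qpoly T (qc z) x = eigshift T z (eigshift T (cnj z) x)"
    "qpoly T (qc z) x = eigshift T (cnj z) (eigshift T z x)"
    by (simp_all add: qpoly_def eigshift_def Lr_linear[OF assms] qscale_diff_left qscale_qscale
        quat_of_complex_commute)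
qed

text \<open>
  Infinite chains model the sequences \<open>\<gamma>\<^sup>(\<^sup>n\<^sup>)(z) / n!\<close> of Taylor coefficients of a frame \<open>\<gamma>\<close> at \<open>z\<close>.
\<close>

definition jordan_chain :: "('a::quat_inner \<Rightarrow> 'a) \<Rightarrow> complex \<Rightarrow> (nat \<Rightarrow> 'a) \<Rightarrow> bool"
  where "jordan_chain T z a \<longleftrightarrow>
    a 0 \<noteq> 0 \<and> eigshift T z (a 0) = 0 \<and> (\<forall>n. eigshift T z (a (Suc n)) = a n)"

lemma jordan_chain_apply:
  assumes "jordan_chain T z a"
  shows "T (a 0) = a 0 \<cdot>\<^sub>q qc z" "T (a (Suc n)) = a (Suc n) \<cdot>\<^sub>q qc z + a n"
  using assms by (simp_all add: jordan_chain_def eigshift_def algebra_simps)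

lemma jordan_chain_invariant:
  assumes "T \<in> Lr" "jordan_chain T z a"
  shows "T ` qspan (a ` {..<n}) \<subseteq> qspan (a ` {..<n})"
proof (rule qspan_image_subset[OF assms(1)], safe)
  fix k assume "k < n"
  show "T (a k) \<in> qspan (a ` {..<n})"
  proof (cases k)
    case 0
    then show ?thesis
      using \<open>k < n\<close> by (auto simp: jordan_chain_apply[OF assms(2)] intro!: qspanD(3)[OF qspan_base])
  next
    case (Suc m)
    then have "a (Suc m) \<in> qspan (a ` {..<n})" "a m \<in> qspan (a ` {..<n})"
      using \<open>k < n\<close> by (auto intro!: qspan_base)
    then show ?thesis
      unfolding Suc jordan_chain_apply[OF assms(2)] by (intro qspanD)
  qed
qed

text \<open>
  Quaternionic independence does not follow by applying the complex-linear map \<open>T - z\<close>, which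
  does not commute with right multiplication by \<open>j\<close>.  The right linear
  \<open>T\<^sup>2 - 2 Re(z) T + |z|\<^sup>2 = (T - z)(T - cnj z)\<close> also lowers the chain by exactly one step, because
  \<open>z - cnj z\<close> is invertible.
\<close>

lemma jordan_chain_independent:
  assumes T: "T \<in> Lr" and a: "jordan_chain T z a" and z: "Im z \<noteq> 0"
  shows "a n \<notin> qspan (a ` {..<n})"
proof (induction n)
  case 0
  then show ?case
    using a by (simp add: qspan_empty jordan_chain_def)
next
  case (Suc n)
  let ?Q = "qpoly T (qc z)"
  have Q0: "?Q (a 0) = 0"
    using a by (simp add: qpoly_eq_eigshift(2)[OF T] jordan_chain_def eigshift_linear[OF T])
  have QSuc: "?Q (a (Suc k)) = eigshift T z (a k) + a k \<cdot>\<^sub>q qc (z - cnj z)" for k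
    using a by (simp add: qpoly_eq_eigshift(2)[OF T] jordan_chain_def)
      (simp add: eigshift_def quat_of_complex_diff qscale_diff_right)
  have shift: "eigshift T z (a k) \<in> qspan (a ` {..<n})" if "k \<le> n" for k
    using that a by (cases k) (auto simp: jordan_chain_def qspanD(1) intro: qspan_base)
  have "?Q ` qspan (a ` {..<Suc n}) \<subseteq> qspan (a ` {..<n})"
  proof (rule qspan_image_subset[OF qpoly_Lr[OF T]], safe)
    fix k assume "k < Suc n"
    then show "?Q (a k) \<in> qspan (a ` {..<n})"
    proof (cases k)
      case (Suc m)
      with \<open>k < Suc n\<close> show ?thesis
        using shift[of m] unfolding Suc QSuc by (intro qspanD) (auto intro: qspan_base)
    qed (simp add: Q0 qspanD)
  qed
  show ?case
  proof
    assume "a (Suc n) \<in> qspan (a ` {..<Suc n})"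
    then have "?Q (a (Suc n)) \<in> qspan (a ` {..<n})"
      using \<open>?Q ` qspan (a ` {..<Suc n}) \<subseteq> qspan (a ` {..<n})\<close> by blast
    then have "?Q (a (Suc n)) - eigshift T z (a n) \<in> qspan (a ` {..<n})"
      using shift[of n] by (intro qspanD) auto
    then have "a n \<cdot>\<^sub>q qc (z - cnj z) \<in> qspan (a ` {..<n})"
      by (simp add: QSuc)
    then have "(a n \<cdot>\<^sub>q qc (z - cnj z)) \<cdot>\<^sub>q inverse (qc (z - cnj z)) \<in> qspan (a ` {..<n})"
      by (rule qspanD)
    moreover have "qc (z - cnj z) \<noteq> 0"
      using z by (simp add: complex_eq_iff)
    ultimately show False
      using Suc by simp
  qed
qed

locale simple_sphere =
  fixes T :: "'a::quat_inner \<Rightarrow> 'a" and z :: complex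
  assumes T: "T \<in> Lr" and Im_nonzero: "Im z \<noteq> 0"
    and range_qpoly: "range (qpoly T (qc z)) = UNIV"
    and qdim_qker: "qdim (qker (qpoly T (qc z))) = 1"
begin

lemma eigenvector_in_qker: "T x = x \<cdot>\<^sub>q qc z \<Longrightarrow> x \<in> qker (qpoly T (qc z))"
  by (simp add: qker_def qpoly_eq_eigshift(2)[OF T] eigshift_linear[OF T]
      eigshift_eq_0_iff[THEN iffD2])

lemma surj_eigshift: "\<exists>x. eigshift T z x = y"
proof -
  have "y \<in> range (qpoly T (qc z))"
    by (simp add: range_qpoly)
  then show ?thesis
    by (auto simp: qpoly_eq_eigshift(1)[OF T])
qed

text \<open>
  A kernel vector \<open>b\<close> that is not an eigenvector for \<open>cnj z\<close> yields one for \<open>z\<close> by applying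
  \<open>T - cnj z\<close>; otherwise right multiplication by \<open>j\<close> turns \<open>cnj z\<close> into \<open>z\<close>.
\<close>

lemma eigenvector_exists: "\<exists>x. x \<noteq> 0 \<and> T x = x \<cdot>\<^sub>q qc z"
proof -
  obtain b where b: "b \<noteq> 0" "qker (qpoly T (qc z)) = range (qscale b)"
    using qker_one_dimensional[OF qpoly_Lr[OF T] qdim_qker] .
  have "b \<in> qker (qpoly T (qc z))"
    unfolding b(2) by (rule range_eqI[of _ _ 1]) simp
  then have 0: "eigshift T z (eigshift T (cnj z) b) = 0"
    by (simp add: qker_def qpoly_eq_eigshift(1)[OF T])
  show ?thesis
  proof (cases "eigshift T (cnj z) b = 0")
    case True
    let ?j = "Quat 0 0 1 0"
    have "T (b \<cdot>\<^sub>q ?j) = b \<cdot>\<^sub>q (qc (cnj z) * ?j)"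
      using True by (simp add: Lr_linear[OF T] eigshift_eq_0_iff qscale_qscale)
    also have "qc (cnj z) * ?j = ?j * qc z"
      by (simp add: quat_eq_iff)
    finally show ?thesis
      using b(1) by (intro exI[of _ "b \<cdot>\<^sub>q ?j"]) (simp add: qscale_qscale quat_eq_iff)
  next
    case False
    with 0 show ?thesis
      using eigshift_eq_0_iff by blast
  qed
qed

lemma qker_eq_eigenvector_line:
  assumes "x \<noteq> 0" "T x = x \<cdot>\<^sub>q qc z"
  shows "qker (qpoly T (qc z)) = range (qscale x)"
proof -
  obtain b where b: "b \<noteq> 0" "qker (qpoly T (qc z)) = range (qscale b)"
    using qker_one_dimensional[OF qpoly_Lr[OF T] qdim_qker] .
  then obtain p where p: "x = b \<cdot>\<^sub>q p"
    using eigenvector_in_qker[OF assms(2)] by auto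
  then have "p \<noteq> 0"
    using assms(1) by auto
  have "range (qscale b) \<subseteq> range (qscale x)"
  proof safe
    fix q
    show "b \<cdot>\<^sub>q q \<in> range (qscale x)"
      by (rule range_eqI[of _ _ "inverse p * q"])
         (use \<open>p \<noteq> 0\<close> in \<open>simp add: p qscale_qscale flip: mult.assoc\<close>)
  qed
  moreover have "range (qscale x) \<subseteq> range (qscale b)"
    by (auto simp: p qscale_qscale)
  ultimately show ?thesis
    using b(2) by auto
qed

lemma eigenvector_unique:
  assumes "x \<noteq> 0" "T x = x \<cdot>\<^sub>q qc z" "T y = y \<cdot>\<^sub>q qc z"
  shows "\<exists>c. y = x \<cdot>\<^sub>q qc c"
proof -
  obtain q where q: "y = x \<cdot>\<^sub>q q"
    using eigenvector_in_qker[OF assms(3)] qker_eq_eigenvector_line[OF assms(1,2)] by auto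
  have "x \<cdot>\<^sub>q (qc z * q - q * qc z) = T y - y \<cdot>\<^sub>q qc z"
    by (simp add: q Lr_linear[OF T] assms(2) qscale_qscale qscale_diff_right)
  then have "qc z * q = q * qc z"
    using assms(1,3) by simp
  then show ?thesis
    using quat_of_complex_commutes_imp_complex[OF _ Im_nonzero] q by blast
qed

text \<open>
  Two chains over the same eigenvalue differ by a triangular change of basis with a constant
  complex diagonal: the correction at level \<open>n\<close>, shifted up by one, accounts for level \<open>n + 1\<close>
  up to an eigenvector.
\<close>

lemma jordan_chain_unique:
  assumes a: "jordan_chain T z a" and b: "jordan_chain T z b"
  obtains c where "c \<noteq> 0" "\<And>n. b n - a n \<cdot>\<^sub>q qc c \<in> qspan (a ` {..<n})"
proof -
  have ker: "\<exists>d. y = a 0 \<cdot>\<^sub>q qc d" if "eigshift T z y = 0" for y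
    using that a eigenvector_unique[of "a 0" y] by (simp add: jordan_chain_def eigshift_eq_0_iff)
  obtain c where c: "b 0 = a 0 \<cdot>\<^sub>q qc c"
    using ker[of "b 0"] b by (auto simp: jordan_chain_def)
  have coeffs: "\<exists>s. b n - a n \<cdot>\<^sub>q qc c = (\<Sum>k<n. a k \<cdot>\<^sub>q qc (s k))" for n
  proof (induction n)
    case (Suc n)
    then obtain s where s: "b n - a n \<cdot>\<^sub>q qc c = (\<Sum>k<n. a k \<cdot>\<^sub>q qc (s k))"
      by blast
    define y where "y = b (Suc n) - a (Suc n) \<cdot>\<^sub>q qc c - (\<Sum>k<n. a (Suc k) \<cdot>\<^sub>q qc (s k))"
    have "eigshift T z y = b n - a n \<cdot>\<^sub>q qc c - (\<Sum>k<n. a k \<cdot>\<^sub>q qc (s k))"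
      using a b by (simp add: y_def eigshift_linear[OF T] jordan_chain_def)
    then obtain d where d: "y = a 0 \<cdot>\<^sub>q qc d"
      using ker s by auto
    have "b (Suc n) - a (Suc n) \<cdot>\<^sub>q qc c = (\<Sum>k<Suc n. a k \<cdot>\<^sub>q qc (case_nat d s k))"
      unfolding sum.lessThan_Suc_shift using d by (simp add: y_def algebra_simps)
    then show ?case
      by blast
  qed (auto simp: c)
  have "b n - a n \<cdot>\<^sub>q qc c \<in> qspan (a ` {..<n})" for n
    using coeffs[of n] by (auto intro!: qsubspace_sum qsubspace_qspan qspanD(3)[OF qspan_base])
  moreover have "c \<noteq> 0"
    using b c by (auto simp: jordan_chain_def)
  ultimately show ?thesis
    using that by blast
qed

end

lemma B1s_simple_sphere:
  assumes "axially_symmetric \<Omega>" "\<Omega> \<inter> \<real> = {}" "T \<in> B1s \<Omega>" "z \<in> reduced \<Omega>"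
  shows "simple_sphere T z"
  using assms(3,4) reduced_iff[OF assms(1,2), of z] by unfold_locales (auto simp: B1s_def)

lemma B1s_eigenvectors_total:
  assumes "axially_symmetric \<Omega>" "\<Omega> \<inter> \<real> = {}" "T \<in> B1s \<Omega>"
    and "qsubspace M" "closed M"
    and "\<And>z x. z \<in> reduced \<Omega> \<Longrightarrow> T x = x \<cdot>\<^sub>q qc z \<Longrightarrow> x \<in> M"
  shows "M = UNIV"
proof -
  have "qker (qpoly T \<omega>) \<subseteq> M" if "\<omega> \<in> \<Omega>" for \<omega>
  proof -
    define z where "z = Complex (qre \<omega>) (norm (qvec \<omega>))"
    have z: "z \<in> reduced \<Omega>"
      using that by (auto simp: z_def reduced_def)
    then interpret simple_sphere T z
      using B1s_simple_sphere assms by blast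
    obtain x where x: "x \<noteq> 0" "T x = x \<cdot>\<^sub>q qc z"
      using eigenvector_exists by blast
    have "qpoly T \<omega> = qpoly T (qc z)"
      using norm_reduced[of \<omega>] by (intro ext) (simp add: qpoly_def z_def)
    then show ?thesis
      using qker_eq_eigenvector_line[OF x] assms(6)[OF z x(2)] qsubspaceD(3)[OF assms(4)] by auto
  qed
  then have "qspan (\<Union>\<omega>\<in>\<Omega>. qker (qpoly T \<omega>)) \<subseteq> M"
    by (intro qspan_minimal assms(4)) auto
  then have "closure (qspan (\<Union>\<omega>\<in>\<Omega>. qker (qpoly T \<omega>))) \<subseteq> M"
    by (rule closure_minimal) (rule assms(5))
  then show ?thesis
    using assms(3) by (auto simp: B1s_def)
qed


section \<open>Bounded preimages\<close>

lemma complete_summable_norm_cancel: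
  fixes f :: "nat \<Rightarrow> 'a::{real_normed_vector, complete_space}"
  assumes "summable (\<lambda>n. norm (f n))"
  shows "summable f" "norm (suminf f) \<le> (\<Sum>n. norm (f n))"
proof -
  let ?N = "\<lambda>n. \<Sum>k<n. norm (f k)"
  have diff: "norm (sum f {..<n} - sum f {..<m}) \<le> norm (?N n - ?N m)" if "m \<le> n" for m n
  proof -
    have ivl: "sum g {..<n} - sum g {..<m} = sum g {m..<n}" for g :: "nat \<Rightarrow> 'b::ab_group_add"
      using sum_diff_nat_ivl[OF le0 that, of g] unfolding atLeast0LessThan .
    have "norm (sum f {..<n} - sum f {..<m}) = norm (sum f {m..<n})"
      unfolding ivl ..
    also have "\<dots> \<le> (\<Sum>k\<in>{m..<n}. norm (f k))"
      by (rule norm_sum)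
    also have "\<dots> = ?N n - ?N m"
      by (simp only: ivl)
    finally show ?thesis
      by simp
  qed
  have "Cauchy ?N"
    using assms by (simp add: summable_iff_convergent convergent_Cauchy)
  then have "Cauchy (\<lambda>n. sum f {..<n})"
    unfolding Cauchy_altdef dist_norm
  proof (intro allI impI)
    fix e :: real
    assume N: "\<forall>e>0. \<exists>M. \<forall>m\<ge>M. \<forall>n>m. norm (?N m - ?N n) < e" and "e > 0"
    then obtain M where M: "\<And>m n. m \<ge> M \<Longrightarrow> n > m \<Longrightarrow> norm (?N m - ?N n) < e"
      by metis
    have "norm (sum f {..<m} - sum f {..<n}) < e" if "m \<ge> M" "n > m" for m n
      using diff[of m n] M[OF that] that(2)
      unfolding norm_minus_commute[of _ "sum _ {..<n}"] by linarith
    then show "\<exists>M. \<forall>m\<ge>M. \<forall>n>m. norm (sum f {..<m} - sum f {..<n}) < e"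
      by blast
  qed
  then show summable: "summable f"
    by (simp add: summable_iff_convergent Cauchy_convergent)
  show "norm (suminf f) \<le> (\<Sum>n. norm (f n))"
  proof (rule LIMSEQ_le)
    show "(\<lambda>n. norm (sum f {..<n})) \<longlonglongrightarrow> norm (suminf f)"
      by (intro tendsto_norm summable_LIMSEQ summable)
    show "?N \<longlonglongrightarrow> (\<Sum>n. norm (f n))"
      by (rule summable_LIMSEQ[OF assms])
  qed (auto intro: norm_sum)
qed

definition bounded_preimages :: "('a::real_normed_vector \<Rightarrow> 'b::real_normed_vector) \<Rightarrow> real \<Rightarrow> bool"
  where "bounded_preimages S C \<longleftrightarrow> (\<forall>y. \<exists>x. S x = y \<and> norm x \<le> C * norm y)"

text \<open>
  Solving up to a residual of half the size can be iterated on the residual, and the corrections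
  are dominated by a geometric series.
\<close>

lemma bounded_preimages_from_approximate:
  fixes S :: "'a::{real_normed_vector, complete_space} \<Rightarrow> 'b::real_normed_vector"
  assumes S: "bounded_linear S" and C: "C \<ge> 0"
    and approx: "\<And>y. \<exists>x. norm x \<le> C * norm y \<and> norm (y - S x) \<le> norm y / 2"
  shows "bounded_preimages S (2 * C)"
  unfolding bounded_preimages_def
proof
  fix y
  obtain p where p: "\<And>y. norm (p y) \<le> C * norm y" "\<And>y. norm (y - S (p y)) \<le> norm y / 2"
    using approx by metis
  define r where "r = rec_nat y (\<lambda>_ u. u - S (p u))"
  have r: "r 0 = y" "r (Suc n) = r n - S (p (r n))" for n
    by (simp_all add: r_def)
  have norm_r: "norm (r n) \<le> norm y * (1 / 2) ^ n" for n
  proof (induction n)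
    case (Suc n)
    then show ?case
      using p(2)[of "r n"] by (simp add: r)
  qed (simp add: r)
  have norm_pr: "norm (p (r n)) \<le> C * norm y * (1 / 2) ^ n" for n
  proof -
    have "C * norm (r n) \<le> C * (norm y * (1 / 2) ^ n)"
      using norm_r[of n] C by (rule mult_left_mono)
    then show ?thesis
      using p(1)[of "r n"] by simp
  qed
  have geo: "summable (\<lambda>n. C * norm y * (1 / 2) ^ n)"
    by (intro summable_mult summable_geometric) simp
  have sum_norm: "summable (\<lambda>n. norm (p (r n)))"
    by (rule summable_norm_comparison_test[OF _ geo]) (blast intro: norm_pr)
  define x where "x = (\<Sum>n. p (r n))"
  have "(\<lambda>n. p (r n)) sums x"
    unfolding x_def by (rule summable_sums[OF complete_summable_norm_cancel(1)[OF sum_norm]])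
  then have "(\<lambda>n. S (p (r n))) sums S x"
    by (rule bounded_linear.sums[OF S])
  moreover have "(\<lambda>n. S (p (r n))) sums y"
  proof -
    have "(\<lambda>n. norm y * (1 / 2) ^ n) \<longlonglongrightarrow> norm y * 0"
      by (intro tendsto_mult tendsto_const LIMSEQ_realpow_zero) auto
    then have "(\<lambda>n. norm y * (1 / 2) ^ n) \<longlonglongrightarrow> 0"
      by simp
    then have "r \<longlonglongrightarrow> 0"
      by (rule Lim_null_comparison[OF always_eventually, rotated]) (simp add: norm_r)
    then have "(\<lambda>n. r n - r (Suc n)) sums (r 0 - 0)"
      by (rule telescope_sums')
    then show ?thesis
      by (simp add: r)
  qed
  ultimately have "S x = y"
    by (rule sums_unique2)
  moreover have "norm x \<le> 2 * C * norm y"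
  proof -
    have "norm x \<le> (\<Sum>n. norm (p (r n)))"
      unfolding x_def by (rule complete_summable_norm_cancel(2)[OF sum_norm])
    also have "\<dots> \<le> (\<Sum>n. C * norm y * (1 / 2) ^ n)"
      by (rule suminf_le[OF norm_pr sum_norm geo])
    also have "\<dots> = 2 * C * norm y"
      using suminf_mult[of "\<lambda>n. (1 / 2 :: real) ^ n" "C * norm y"] suminf_geometric[of "1 / 2 :: real"]
      by (simp add: summable_geometric)
    finally show ?thesis .
  qed
  ultimately show "\<exists>x. S x = y \<and> norm x \<le> 2 * C * norm y"
    by blast
qed

text \<open>
  The open mapping theorem in quantitative form.  By Baire's theorem the closure of the image of
  some ball has interior; differences of two points of that ball then reach every small vector
  approximately.
\<close>

theorem bounded_preimages_of_surj:
  fixes S :: "'a::{real_normed_vector, complete_space} \<Rightarrow> 'b::{real_normed_vector, complete_space}"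
  assumes S: "bounded_linear S" and surj: "surj S"
  obtains C where "C > 0" "bounded_preimages S C"
proof -
  interpret S: bounded_linear S by (rule S)
  define F where "F n = closure (S ` cball 0 (real n))" for n :: nat
  have "\<exists>n. interior (F n) \<noteq> {}"
  proof (rule ccontr)
    assume *: "\<nexists>n. interior (F n) \<noteq> {}"
    have "(euclidean :: 'b topology) interior_of \<Union>(range F) = {}"
      by (rule Baire_category_alt)
         (use * in \<open>auto simp: completely_metrizable_space_euclidean F_def\<close>)
    moreover have "\<Union>(range F) = UNIV"
    proof -
      have "y \<in> \<Union>(range F)" for y
      proof -
        obtain x where "S x = y"
          using surj by (metis surjD)
        moreover obtain n where "norm x \<le> real n"
          using real_arch_simple by blast
        ultimately have "y \<in> F n"
          unfolding F_def by (intro closure_subset[THEN subsetD]) auto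
        then show ?thesis
          by blast
      qed
      then show ?thesis
        by blast
    qed
    ultimately show False
      by simp
  qed
  then obtain n y0 \<epsilon> where \<epsilon>: "\<epsilon> > 0" and ball: "ball y0 \<epsilon> \<subseteq> F n"
    by (metis all_not_in_conv mem_interior)
  have near: "\<exists>u. norm u \<le> real n \<and> norm (y - S u) < \<epsilon> / 8" if "y \<in> ball y0 \<epsilon>" for y
  proof -
    have "y \<in> F n"
      using that ball by blast
    then obtain v where "v \<in> S ` cball 0 (real n)" "dist v y < \<epsilon> / 8"
      unfolding F_def using \<epsilon> closure_approachable[of y "S ` cball 0 (real n)"]
      by (metis divide_pos_pos zero_less_numeral)
    then show ?thesis
      by (auto simp: dist_norm norm_minus_commute)
  qed
  define C where "C = (4 * real n + 1) / \<epsilon>"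
  have C: "C > 0"
    using \<epsilon> by (simp add: C_def)
  have "\<exists>x. norm x \<le> C * norm y \<and> norm (y - S x) \<le> norm y / 2" for y
  proof (cases "y = 0")
    case False
    \<comment> \<open>Rescale \<open>y\<close> into the ball, where it is a difference of two approximable points.\<close>
    define t where "t = \<epsilon> / (2 * norm y)"
    have t: "t > 0" "t * norm y = \<epsilon> / 2" "inverse t = 2 * norm y / \<epsilon>"
      using False \<epsilon> by (simp_all add: t_def field_simps)
    obtain u where u: "norm u \<le> real n" "norm (y0 + t *\<^sub>R y - S u) < \<epsilon> / 8"
      using near[of "y0 + t *\<^sub>R y"] t \<epsilon> by (auto simp: dist_norm)
    obtain v where v: "norm v \<le> real n" "norm (y0 - S v) < \<epsilon> / 8"
      using near[of y0] \<epsilon> by auto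
    define x where "x = inverse t *\<^sub>R (u - v)"
    have "norm (t *\<^sub>R y - S (u - v)) \<le> norm (y0 + t *\<^sub>R y - S u) + norm (y0 - S v)"
      using norm_triangle_ineq4[of "y0 + t *\<^sub>R y - S u" "y0 - S v"] by (simp add: S.diff algebra_simps)
    then have res: "norm (t *\<^sub>R y - S (u - v)) \<le> \<epsilon> / 4"
      using u v by linarith
    have "S x = inverse t *\<^sub>R S (u - v)"
      by (simp only: x_def S.scaleR)
    then have "y - S x = inverse t *\<^sub>R (t *\<^sub>R y - S (u - v))"
      using t(1) by (simp add: scaleR_diff_right)
    then have "norm (y - S x) = inverse t * norm (t *\<^sub>R y - S (u - v))"
      using t(1) by simp
    also have "\<dots> \<le> inverse t * (\<epsilon> / 4)"
      using res t(1) by (intro mult_left_mono) auto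
    also have "\<dots> = norm y / 2"
      using \<epsilon> by (simp add: t(3))
    finally have 1: "norm (y - S x) \<le> norm y / 2" .
    have "norm x \<le> inverse t * (2 * real n)"
      using t(1) u(1) v(1) norm_triangle_ineq4[of u v] by (simp add: x_def)
    also have "\<dots> \<le> C * norm y"
      using \<epsilon> unfolding t(3) by (simp add: C_def field_simps)
    finally show ?thesis
      using 1 by blast
  qed (auto intro!: exI[of _ 0] simp: S.zero)
  then have "bounded_preimages S (2 * C)"
    using C by (intro bounded_preimages_from_approximate[OF S]) auto
  with C that[of "2 * C"] show ?thesis
    by simp
qed

text \<open>
  A solution for \<open>z\<close> solves the equation for \<open>w\<close> up to the small error \<open>x (w - z)\<close>.  The constant thus
  grows at most by the factor 2 on a neighbourhood of \<open>z\<close>, which makes the radii of convergence below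
  locally uniform.
\<close>

lemma bounded_preimages_eigshift_nearby:
  fixes T :: "'a::{quat_inner, complete_space} \<Rightarrow> 'a"
  assumes T: "T \<in> Lr" and C: "bounded_preimages (eigshift T z) C" and "C \<ge> 0"
    and near: "cmod (w - z) * C \<le> 1 / 2"
  shows "bounded_preimages (eigshift T w) (2 * C)"
proof (rule bounded_preimages_from_approximate[OF bounded_linear_eigshift[OF T] \<open>C \<ge> 0\<close>])
  fix y
  obtain x where x: "eigshift T z x = y" "norm x \<le> C * norm y"
    using C by (auto simp: bounded_preimages_def)
  have "y - eigshift T w x = x \<cdot>\<^sub>q qc (w - z)"
    by (simp add: x(1)[symmetric] eigshift_def quat_of_complex_diff qscale_diff_right)
  then have "norm (y - eigshift T w x) \<le> C * norm y * cmod (w - z)"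
    using x(2) by (simp add: mult_right_mono)
  also have "\<dots> \<le> 1 / 2 * norm y"
    using mult_right_mono[OF near norm_ge_zero[of y]] by (simp add: algebra_simps)
  finally show "\<exists>x. norm x \<le> C * norm y \<and> norm (y - eigshift T w x) \<le> norm y / 2"
    using x(2) by auto
qed


section \<open>Power series of eigenvectors\<close>

definition qseries :: "(nat \<Rightarrow> 'a::quat_inner) \<Rightarrow> complex \<Rightarrow> 'a"
  where "qseries b w = (\<Sum>n. b n \<cdot>\<^sub>q qc (w ^ n))"

context
  fixes b :: "nat \<Rightarrow> 'a::{quat_inner, complete_space}" and K C :: real
  assumes bound: "\<And>n. norm (b n) \<le> K * C ^ n" and C: "C > 0"
begin

lemma qseries_term_bound: "norm (b n \<cdot>\<^sub>q qc (w ^ n)) \<le> K * (C * cmod w) ^ n"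
  using mult_right_mono[OF bound[of n], of "cmod w ^ n"]
  by (simp add: norm_power power_mult_distrib mult.assoc)

lemma qseries_sums:
  assumes "C * cmod w < 1"
  shows "(\<lambda>n. b n \<cdot>\<^sub>q qc (w ^ n)) sums qseries b w"
  unfolding qseries_def
proof (rule summable_sums[OF complete_summable_norm_cancel(1)])
  have "norm (C * cmod w) < 1"
    using assms C by simp
  then have geo: "summable (\<lambda>n. K * (C * cmod w) ^ n)"
    by (rule summable_mult[OF summable_geometric])
  show "summable (\<lambda>n. norm (b n \<cdot>\<^sub>q qc (w ^ n)))"
    by (rule summable_norm_comparison_test[OF _ geo]) (blast intro: qseries_term_bound)
qed

lemma qseries_tail_bound:
  assumes "C * cmod w < 1"
  shows "norm (qseries b w - b 0) \<le> K * (C * cmod w / (1 - C * cmod w))"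
proof -
  define t where "t = C * cmod w"
  have t: "0 \<le> t" "t < 1"
    using assms C by (auto simp: t_def)
  have tail: "(\<lambda>n. b (Suc n) \<cdot>\<^sub>q qc (w ^ Suc n)) sums (qseries b w - b 0)"
    using qseries_sums[OF assms]
      sums_Suc_iff[of "\<lambda>n. b n \<cdot>\<^sub>q qc (w ^ n)" "qseries b w - b 0"] by simp
  have geo: "(\<lambda>n. K * t * t ^ n) sums (K * t * (1 / (1 - t)))"
    using t by (intro sums_mult geometric_sums) auto
  have le: "norm (b (Suc n) \<cdot>\<^sub>q qc (w ^ Suc n)) \<le> K * t * t ^ n" for n
    using qseries_term_bound[of "Suc n" w] by (simp add: t_def mult_ac)
  have sum: "summable (\<lambda>n. norm (b (Suc n) \<cdot>\<^sub>q qc (w ^ Suc n)))"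
    by (rule summable_norm_comparison_test[OF _ sums_summable[OF geo]]) (blast intro: le)
  have "norm (qseries b w - b 0) \<le> (\<Sum>n. norm (b (Suc n) \<cdot>\<^sub>q qc (w ^ Suc n)))"
    using complete_summable_norm_cancel(2)[OF sum] sums_unique[OF tail] by simp
  also have "\<dots> \<le> K * t * (1 / (1 - t))"
    using suminf_le[OF le sum sums_summable[OF geo]] sums_unique[OF geo] by simp
  finally show ?thesis
    by (simp add: t_def)
qed

lemma qseries_in_closed_subspace:
  assumes "qsubspace M" "closed M" "\<And>n. b n \<in> M" "C * cmod w < 1"
  shows "qseries b w \<in> M"
proof (rule closed_sequentially[OF assms(2)])
  show "(\<lambda>n. \<Sum>k<n. b k \<cdot>\<^sub>q qc (w ^ k)) \<longlonglongrightarrow> qseries b w"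
    using qseries_sums[OF assms(4)] by (simp add: sums_def)
  show "(\<Sum>k<n. b k \<cdot>\<^sub>q qc (w ^ k)) \<in> M" for n
    by (intro qsubspace_sum assms(1) qsubspaceD(3)[OF assms(1)] assms(3))
qed

lemma qseries_head_in_closed_subspace:
  assumes "closed M" "\<epsilon> > 0" "\<And>w. w \<noteq> 0 \<Longrightarrow> cmod w < \<epsilon> \<Longrightarrow> qseries b w \<in> M"
  shows "b 0 \<in> M"
proof -
  have lim: "((\<lambda>w. qseries b w) \<longlongrightarrow> b 0) (at 0)"
  proof (rule Lim_transform2[OF tendsto_const], rule Lim_null_comparison)
    have "((\<lambda>w. K * (C * cmod w / (1 - C * cmod w))) \<longlongrightarrow> K * (C * cmod 0 / (1 - C * cmod 0))) (at 0)"
      by (intro tendsto_intros) simp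
    then show "((\<lambda>w. K * (C * cmod w / (1 - C * cmod w))) \<longlongrightarrow> 0) (at 0)"
      by simp
    have "\<forall>\<^sub>F w in at 0. C * cmod w < 1"
    proof (rule order_tendstoD)
      show "((\<lambda>w. C * cmod w) \<longlongrightarrow> C * cmod 0) (at 0)"
        by (intro tendsto_intros)
    qed simp
    then show "\<forall>\<^sub>F w in at 0. norm (b 0 - qseries b w) \<le> K * (C * cmod w / (1 - C * cmod w))"
      by eventually_elim (metis qseries_tail_bound norm_minus_commute)
  qed
  have "\<forall>\<^sub>F w in at 0. qseries b w \<in> M"
    unfolding eventually_at using assms(2,3) by (intro exI[of _ \<epsilon>]) auto
  then show ?thesis
    by (rule Lim_in_closed_set[OF assms(1) _ _ lim]) simp
qed

end

text \<open>
  Once \<open>b 0\<close> is known to lie in the subspace, so does \<open>(qseries b w - b 0) w\<^sup>-\<^sup>1\<close>, which is the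
  series of the shifted coefficients.
\<close>

lemma qseries_coefficients_in_closed_subspace:
  fixes b :: "nat \<Rightarrow> 'a::{quat_inner, complete_space}"
  assumes "\<And>n. norm (b n) \<le> K * C ^ n" "C > 0" "qsubspace M" "closed M"
    and "\<epsilon> > 0" "\<And>w. w \<noteq> 0 \<Longrightarrow> cmod w < \<epsilon> \<Longrightarrow> qseries b w \<in> M" "\<epsilon> * C \<le> 1"
  shows "b m \<in> M"
  using assms(1,6)
proof (induction m arbitrary: b K)
  case 0
  then show ?case
    using qseries_head_in_closed_subspace[of b K C M \<epsilon>] assms by blast
next
  case (Suc m)
  note bound = Suc.prems(1)
  have b0: "b 0 \<in> M"
    using qseries_head_in_closed_subspace[of b K C M \<epsilon>] Suc.prems assms by blast
  have bound': "norm (b (Suc n)) \<le> K * C * C ^ n" for n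
    using bound[of "Suc n"] by (simp add: mult_ac)
  have "qseries (\<lambda>n. b (Suc n)) w \<in> M" if "w \<noteq> 0" "cmod w < \<epsilon>" for w
  proof -
    have "cmod w * C < \<epsilon> * C"
      using that(2) assms(2) by simp
    then have w: "C * cmod w < 1"
      using assms(7) by (simp add: mult.commute)
    have "(\<lambda>n. (b (Suc n) \<cdot>\<^sub>q qc (w ^ n)) \<cdot>\<^sub>q qc w) sums (qseries (\<lambda>n. b (Suc n)) w \<cdot>\<^sub>q qc w)"
      by (intro bounded_linear.sums[OF bounded_linear_qscale] qseries_sums[OF bound' assms(2) w])
    moreover have "(\<lambda>n. b (Suc n) \<cdot>\<^sub>q qc (w ^ Suc n)) sums (qseries b w - b 0)"
      using qseries_sums[OF bound assms(2) w]
        sums_Suc_iff[of "\<lambda>n. b n \<cdot>\<^sub>q qc (w ^ n)" "qseries b w - b 0"] by simp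
    ultimately have "qseries (\<lambda>n. b (Suc n)) w \<cdot>\<^sub>q qc w = qseries b w - b 0"
      by (intro sums_unique2) (simp_all add: qscale_qscale quat_of_complex_mult[symmetric] mult.commute)
    then have "qseries (\<lambda>n. b (Suc n)) w = (qseries b w - b 0) \<cdot>\<^sub>q inverse (qc w)"
      using that(1) by (metis qscale_inverse_cancel(1) quat_of_complex_eq_0_iff)
    then show ?thesis
      using Suc.prems(2)[OF that] b0 by (simp add: qsubspaceD[OF assms(3)])
  qed
  then show ?case
    using Suc.IH[of "\<lambda>n. b (Suc n)" "K * C"] bound' by blast
qed

text \<open>
  Along a Jordan chain, \<open>T\<close> acts on the coefficients as multiplication by \<open>z\<close> plus a shift, and a
  shift of coefficients is multiplication of the series by \<open>w\<close>.
\<close>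

lemma qseries_jordan_chain_eigenvector:
  fixes b :: "nat \<Rightarrow> 'a::{quat_inner, complete_space}"
  assumes T: "T \<in> Lr" and b: "jordan_chain T z b"
    and bound: "\<And>n. norm (b n) \<le> K * C ^ n" and C: "C > 0" and w: "C * cmod w < 1"
  shows "T (qseries b w) = qseries b w \<cdot>\<^sub>q qc (z + w)"
proof (rule sums_unique2)
  let ?G = "qseries b w"
  note G = qseries_sums[OF bound C w]
  show "(\<lambda>n. T (b n \<cdot>\<^sub>q qc (w ^ n))) sums T ?G"
    by (rule bounded_linear.sums[OF Lr_bounded_linear[OF T] G])
  let ?s = "\<lambda>n. case n of 0 \<Rightarrow> 0 | Suc m \<Rightarrow> b m \<cdot>\<^sub>q qc (w ^ m) \<cdot>\<^sub>q qc w"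
  have "(\<lambda>n. ?s (Suc n)) sums (?G \<cdot>\<^sub>q qc w)"
    using bounded_linear.sums[OF bounded_linear_qscale G] by simp
  then have "?s sums (?G \<cdot>\<^sub>q qc w)"
    using sums_Suc[of ?s] by simp
  then have "(\<lambda>n. b n \<cdot>\<^sub>q qc (w ^ n) \<cdot>\<^sub>q qc z + ?s n) sums (?G \<cdot>\<^sub>q qc z + ?G \<cdot>\<^sub>q qc w)"
    by (intro sums_add bounded_linear.sums[OF bounded_linear_qscale G])
  moreover have "b n \<cdot>\<^sub>q qc (w ^ n) \<cdot>\<^sub>q qc z + ?s n = T (b n \<cdot>\<^sub>q qc (w ^ n))" for n
    using jordan_chain_apply[OF b]
    by (cases n) (simp_all add: Lr_linear[OF T] qscale_add_left qscale_qscale mult.commute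
        flip: quat_of_complex_mult)
  ultimately show "(\<lambda>n. T (b n \<cdot>\<^sub>q qc (w ^ n))) sums (?G \<cdot>\<^sub>q qc (z + w))"
    by (simp add: quat_of_complex_add qscale_add_right)
qed

lemma bounded_jordan_chain_exists:
  assumes "bounded_preimages (eigshift T z) C" "C > 0" "x \<noteq> 0" "T x = x \<cdot>\<^sub>q qc z"
  obtains b where "jordan_chain T z b" "b 0 = x" "\<And>n. norm (b n) \<le> norm x * C ^ n"
proof -
  obtain p where p: "\<And>y. eigshift T z (p y) = y" "\<And>y. norm (p y) \<le> C * norm y"
    using assms(1) unfolding bounded_preimages_def by metis
  define b where "b = rec_nat x (\<lambda>_. p)"
  have b: "b 0 = x" "b (Suc n) = p (b n)" for n
    by (simp_all add: b_def)
  have "norm (b n) \<le> norm x * C ^ n" for n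
  proof (induction n)
    case (Suc n)
    then have "C * norm (b n) \<le> C * (norm x * C ^ n)"
      using assms(2) by simp
    then show ?case
      using p(2)[of "b n"] by (simp add: b mult_ac)
  qed (simp add: b)
  moreover have "jordan_chain T z b"
    using assms(3,4) by (simp add: jordan_chain_def b p eigshift_eq_0_iff[THEN iffD2])
  ultimately show ?thesis
    using that b(1) by blast
qed


section \<open>Jordan chains span a dense subspace\<close>

text \<open>
  For \<open>C |w - z| < 1/2\<close> the tail of the series is shorter than \<open>b 0\<close>, so that its value is a nonzero
  eigenvector for \<open>w\<close>; all others are complex multiples of it.
\<close>

lemma eigenvectors_near_chain_in_subspace:
  fixes T :: "'a::{quat_inner, complete_space} \<Rightarrow> 'a"
  assumes T: "T \<in> Lr" and b: "jordan_chain T z b"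
    and bound: "\<And>n. norm (b n) \<le> norm (b 0) * C ^ n" and C: "C > 0"
    and M: "qsubspace M" "closed M" "\<And>n. b n \<in> M"
    and w: "simple_sphere T w" "C * cmod (w - z) < 1 / 2" and x: "T x = x \<cdot>\<^sub>q qc w"
  shows "x \<in> M"
proof -
  interpret w: simple_sphere T w by (rule w(1))
  define t where "t = C * cmod (w - z)"
  have t: "0 \<le> t" "t < 1 / 2"
    using C w(2) by (auto simp: t_def)
  let ?G = "qseries b (w - z)"
  have G: "T ?G = ?G \<cdot>\<^sub>q qc w"
    using qseries_jordan_chain_eigenvector[OF T b bound C, of "w - z"] t by (simp add: t_def)
  have "t / (1 - t) < 1"
    using t by (simp add: field_simps)
  moreover have "norm (b 0) > 0"
    using b by (simp add: jordan_chain_def)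
  ultimately have "norm (b 0) * (t / (1 - t)) < norm (b 0) * 1"
    by (intro mult_strict_left_mono)
  then have "norm (?G - b 0) < norm (b 0)"
    using qseries_tail_bound[of b "norm (b 0)" C "w - z"] bound C t by (auto simp: t_def)
  then have "?G \<noteq> 0"
    by auto
  then obtain c where "x = ?G \<cdot>\<^sub>q qc c"
    using w.eigenvector_unique[OF _ G x] by blast
  moreover have "?G \<in> M"
    using t by (intro qseries_in_closed_subspace[OF bound C M]) (simp add: t_def)
  ultimately show ?thesis
    by (simp add: qsubspaceD[OF M(1)])
qed

text \<open>
  Let \<open>M\<close> be the closed span and \<open>W\<close> the set of points near which every eigenvector lies in \<open>M\<close>.  The
  power series at \<open>z0\<close> shows that \<open>z0\<close> is in \<open>W\<close>.  At any point of \<open>W\<close> the coefficients of the power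
  series lie in \<open>M\<close> again, hence so do its values on the full disc where it produces eigenvectors.  The
  size of these discs is locally bounded below, so \<open>W\<close> is both open and closed in the reduced set.
\<close>

theorem jordan_chain_total:
  fixes T :: "'a::{quat_inner, complete_space} \<Rightarrow> 'a"
  assumes \<Omega>: "axially_symmetric \<Omega>" "\<Omega> \<inter> \<real> = {}" "open \<Omega>" "connected \<Omega>"
    and B1s: "T \<in> B1s \<Omega>" and z0: "z0 \<in> reduced \<Omega>" and a: "jordan_chain T z0 a"
  shows "closure (qspan (range a)) = UNIV"
proof -
  let ?R = "reduced \<Omega>"
  define M where "M = closure (qspan (range a))"
  have M: "qsubspace M" "closed M"
    by (simp_all add: M_def qsubspace_closure qsubspace_qspan)
  have T: "T \<in> Lr"
    using B1s by (simp add: B1s_def)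
  have sphere: "simple_sphere T z" if "z \<in> ?R" for z
    using B1s_simple_sphere \<Omega> B1s that by blast
  have openR: "open ?R"
    by (rule open_reduced[OF \<Omega>(1-3)])
  define filled where
    "filled A \<longleftrightarrow> (\<forall>z\<in>A \<inter> ?R. \<forall>x. T x = x \<cdot>\<^sub>q qc z \<longrightarrow> x \<in> M)" for A
  define W where "W = {z \<in> ?R. \<exists>\<epsilon>>0. filled (ball z \<epsilon>)}"
  have preimages: "\<exists>C>0. bounded_preimages (eigshift T z) C" if "z \<in> ?R" for z
  proof -
    interpret simple_sphere T z
      by (rule sphere[OF that])
    have "surj (eigshift T z)"
      using surj_eigshift by (metis surj_def)
    then show ?thesis
      using bounded_preimages_of_surj[OF bounded_linear_eigshift[OF T]] by metis
  qed
  have spread: "filled (ball z (1 / (2 * C)))"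
    if "jordan_chain T z b" "\<And>n. norm (b n) \<le> norm (b 0) * C ^ n" "C > 0" "\<And>n. b n \<in> M" for z b C
    unfolding filled_def
  proof (intro ballI allI impI)
    fix w x assume w: "w \<in> ball z (1 / (2 * C)) \<inter> ?R" and x: "T x = x \<cdot>\<^sub>q qc w"
    have "C * cmod (w - z) < 1 / 2"
      using w that(3) by (simp add: dist_norm norm_minus_commute field_simps)
    then show "x \<in> M"
      using eigenvectors_near_chain_in_subspace[OF T that(1-3) M that(4) sphere _ x] w by blast
  qed
  have "z0 \<in> W"
  proof -
    interpret simple_sphere T z0
      by (rule sphere[OF z0])
    obtain C where C: "C > 0" "bounded_preimages (eigshift T z0) C"
      using preimages[OF z0] by blast
    have "a 0 \<noteq> 0" "T (a 0) = a 0 \<cdot>\<^sub>q qc z0"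
      using a by (simp_all add: jordan_chain_def eigshift_eq_0_iff)
    then obtain b where b: "jordan_chain T z0 b" "\<And>n. norm (b n) \<le> norm (b 0) * C ^ n"
      using bounded_jordan_chain_exists[OF C(2,1)] by metis
    obtain c where c: "\<And>n. b n - a n \<cdot>\<^sub>q qc c \<in> qspan (a ` {..<n})"
      using jordan_chain_unique[OF a b(1)] by blast
    have "b n \<in> qspan (range a)" for n
    proof -
      have "b n - a n \<cdot>\<^sub>q qc c \<in> qspan (range a)"
        using c[of n] qspan_mono[of "a ` {..<n}" "range a"] by auto
      moreover have "a n \<cdot>\<^sub>q qc c \<in> qspan (range a)"
        by (intro qspanD qspan_base) simp
      ultimately have "(b n - a n \<cdot>\<^sub>q qc c) + a n \<cdot>\<^sub>q qc c \<in> qspan (range a)"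
        by (rule qspanD)
      then show ?thesis
        by simp
    qed
    then have "b n \<in> M" for n
      unfolding M_def using closure_subset by blast
    then have "filled (ball z0 (1 / (2 * C)))"
      by (intro spread[OF b C(1)])
    then show ?thesis
      using z0 C(1) unfolding W_def by (auto intro!: exI[of _ "1 / (2 * C)"])
  qed
  \<comment> \<open>The radius on which filling spreads from a point of \<open>W\<close> is bounded below near every \<open>z\<close>,
     so points of \<open>W\<close> close to \<open>z\<close> reach past \<open>z\<close>.\<close>
  have uniform: "\<exists>\<delta>>0. \<forall>z1\<in>W. dist z1 z < \<delta> \<longrightarrow> filled (ball z \<delta>)" if z: "z \<in> ?R" for z
  proof -
    obtain C where C: "C > 0" "bounded_preimages (eigshift T z) C"
      using preimages[OF z] by blast
    define \<delta> where "\<delta> = 1 / (8 * C)"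
    have \<delta>: "\<delta> > 0" "2 * \<delta> = 1 / (2 * (2 * C))"
      using C(1) by (simp_all add: \<delta>_def)
    have "filled (ball z \<delta>)" if z1: "z1 \<in> W" "dist z1 z < \<delta>" for z1
    proof -
      have "z1 \<in> ?R"
        using z1(1) by (simp add: W_def)
      interpret simple_sphere T z1
        by (rule sphere[OF \<open>z1 \<in> ?R\<close>])
      have "cmod (z1 - z) * C < \<delta> * C"
        using z1(2) C(1) by (simp add: dist_norm)
      also have "\<dots> = 1 / 8"
        using C(1) by (simp add: \<delta>_def)
      finally have C1: "bounded_preimages (eigshift T z1) (2 * C)"
        using C(1) by (intro bounded_preimages_eigshift_nearby[OF T C(2)]) auto
      obtain x where "x \<noteq> 0" "T x = x \<cdot>\<^sub>q qc z1"
        using eigenvector_exists by blast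
      then obtain b where b: "jordan_chain T z1 b" "\<And>n. norm (b n) \<le> norm (b 0) * (2 * C) ^ n"
        using bounded_jordan_chain_exists[OF C1] C(1) by (metis mult_pos_pos zero_less_numeral)
      obtain \<epsilon>1 where \<epsilon>1: "\<epsilon>1 > 0" "filled (ball z1 \<epsilon>1)"
        using z1(1) by (auto simp: W_def)
      obtain \<epsilon>2 where \<epsilon>2: "\<epsilon>2 > 0" "ball z1 \<epsilon>2 \<subseteq> ?R"
        using openR \<open>z1 \<in> ?R\<close> openE by blast
      define \<epsilon> where "\<epsilon> = min (min \<epsilon>1 \<epsilon>2) (1 / (2 * C))"
      have \<epsilon>: "\<epsilon> > 0" "\<epsilon> * (2 * C) \<le> 1"
      proof -
        show "\<epsilon> > 0"
          using \<epsilon>1 \<epsilon>2 C(1) by (simp add: \<epsilon>_def)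
        have "\<epsilon> * (2 * C) \<le> 1 / (2 * C) * (2 * C)"
          using C(1) by (intro mult_right_mono) (auto simp: \<epsilon>_def)
        then show "\<epsilon> * (2 * C) \<le> 1"
          using C(1) by simp
      qed
      have "qseries b w \<in> M" if "w \<noteq> 0" "cmod w < \<epsilon>" for w
      proof -
        have "cmod w * (2 * C) < \<epsilon> * (2 * C)"
          using that(2) C(1) by simp
        then have "2 * C * cmod w < 1"
          using \<epsilon>(2) by (simp add: mult_ac)
        then have "T (qseries b w) = qseries b w \<cdot>\<^sub>q qc (z1 + w)"
          using qseries_jordan_chain_eigenvector[OF T b] C(1) by simp
        moreover have "z1 + w \<in> ball z1 \<epsilon>1 \<inter> ?R"
          using that(2) \<epsilon>2(2) by (auto simp: \<epsilon>_def dist_norm)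
        ultimately show ?thesis
          using \<epsilon>1(2) unfolding filled_def by blast
      qed
      then have "b n \<in> M" for n
        using qseries_coefficients_in_closed_subspace[OF b(2) _ M \<epsilon>(1) _ \<epsilon>(2)] C(1) by simp
      then have "filled (ball z1 (2 * \<delta>))"
        using spread[OF b] C(1) unfolding \<delta>(2) by simp
      moreover have "ball z \<delta> \<subseteq> ball z1 (2 * \<delta>)"
      proof
        fix y assume "y \<in> ball z \<delta>"
        then show "y \<in> ball z1 (2 * \<delta>)"
          using z1(2) dist_triangle[of z1 y z] by simp
      qed
      ultimately show ?thesis
        unfolding filled_def by blast
    qed
    with \<delta>(1) show ?thesis
      by blast
  qed
  have all_W: "z \<in> W" if "z \<in> ?R" for z
  proof (rule connected_induction_simple[where S = ?R and a = z0])
    show "connected ?R"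
      by (rule connected_reduced[OF \<Omega>(4)])
    show "\<exists>A. openin (top_of_set ?R) A \<and> y \<in> A \<and> (\<forall>u\<in>A. \<forall>v\<in>A. u \<in> W \<longrightarrow> v \<in> W)"
      if y: "y \<in> ?R" for y
    proof -
      obtain \<delta> where \<delta>: "\<delta> > 0" "\<And>z1. z1 \<in> W \<Longrightarrow> dist z1 y < \<delta> \<Longrightarrow> filled (ball y \<delta>)"
        using uniform[OF y] by blast
      have "v \<in> W" if uv: "u \<in> ?R \<inter> ball y \<delta>" "v \<in> ?R \<inter> ball y \<delta>" "u \<in> W" for u v
      proof -
        have "filled (ball y \<delta>)"
          using uv \<delta>(2)[of u] by (simp add: dist_commute)
        moreover obtain \<epsilon> where "\<epsilon> > 0" "ball v \<epsilon> \<subseteq> ball y \<delta>"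
          using uv(2) open_ball openE by blast
        ultimately show ?thesis
          using uv(2) unfolding W_def filled_def by blast
      qed
      moreover have "openin (top_of_set ?R) (?R \<inter> ball y \<delta>)"
        by (rule openin_open_Int[OF open_ball])
      moreover have "y \<in> ?R \<inter> ball y \<delta>"
        using y \<delta>(1) by simp
      ultimately show ?thesis
        by (intro exI[of _ "?R \<inter> ball y \<delta>"]) blast
    qed
  qed (use z0 \<open>z0 \<in> W\<close> that in auto)
  have "M = UNIV"
  proof (rule B1s_eigenvectors_total[OF \<Omega>(1,2) B1s M])
    fix z x assume "z \<in> ?R" "T x = x \<cdot>\<^sub>q qc z"
    moreover from this obtain \<epsilon> where "\<epsilon> > 0" "filled (ball z \<epsilon>)"
      using all_W by (auto simp: W_def)
    ultimately show "x \<in> M"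
      unfolding filled_def by auto
  qed
  then show ?thesis
    by (simp add: M_def)
qed


section \<open>Right holomorphic maps\<close>

text \<open>
  Rephrasing right complex differentiability as a Frechet derivative gives access to the product
  and chain rules.
\<close>

lemma has_right_deriv_iff_has_derivative:
  "has_right_deriv f D z \<longleftrightarrow> (f has_derivative (\<lambda>h. D \<cdot>\<^sub>q qc h)) (at z)"
proof -
  have lin: "bounded_linear (\<lambda>h. D \<cdot>\<^sub>q qc h)"
    by (rule bounded_linear_compose[OF bounded_bilinear.bounded_linear_right[OF bounded_bilinear_qscale]
        bounded_linear_quat_of_complex])
  have eq: "norm (f (z + h) - f z - D \<cdot>\<^sub>q qc h) / norm h
      = norm ((f (z + h) - f z) \<cdot>\<^sub>q inverse (qc h) - D)" if "h \<noteq> 0" for h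
  proof -
    have "(f (z + h) - f z) \<cdot>\<^sub>q inverse (qc h) - D = (f (z + h) - f z - D \<cdot>\<^sub>q qc h) \<cdot>\<^sub>q inverse (qc h)"
      using that by (simp add: qscale_diff_left qscale_qscale)
    then show ?thesis
      by (simp add: norm_inverse divide_inverse)
  qed
  have "has_right_deriv f D z
      \<longleftrightarrow> ((\<lambda>h. norm ((f (z + h) - f z) \<cdot>\<^sub>q inverse (qc h) - D)) \<longlongrightarrow> 0) (at 0)"
    unfolding has_right_deriv_def by (subst Lim_null) (rule tendsto_norm_zero_iff[symmetric])
  also have "\<dots> \<longleftrightarrow> ((\<lambda>h. norm (f (z + h) - f z - D \<cdot>\<^sub>q qc h) / norm h) \<longlongrightarrow> 0) (at 0)"
    by (rule Lim_cong_within) (simp_all add: eq)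
  finally show ?thesis
    by (simp add: has_derivative_at lin)
qed

lemma right_deriv_eq: "has_right_deriv f D z \<Longrightarrow> right_deriv f z = D"
  unfolding right_deriv_def
  by (rule the_equality) (auto simp: has_right_deriv_def intro: tendsto_unique[rotated])

lemma right_holomorphic_has_derivative:
  assumes "right_holomorphic_on f S" "z \<in> S"
  shows "(f has_derivative (\<lambda>h. right_deriv f z \<cdot>\<^sub>q qc h)) (at z)"
  using assms right_deriv_eq unfolding right_holomorphic_on_def has_right_deriv_iff_has_derivative
  by (metis has_right_deriv_iff_has_derivative)

lemma has_derivative_zero_if_locally_zero:
  assumes "(f has_derivative f') (at z)" "open S" "z \<in> S" "\<And>w. w \<in> S \<Longrightarrow> f w = 0"
  shows "f' h = 0"
proof -
  have "((\<lambda>_. 0) has_derivative f') (at z)"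
    by (rule has_derivative_transform_within_open[OF assms(1-3)]) (simp add: assms(4))
  then have "f' = (\<lambda>_. 0)"
    by (rule has_derivative_unique) simp
  then show ?thesis
    by simp
qed

text \<open>
  Right multiplication by \<open>i\<close> turns the quaternions into a complex vector space;
  \<open>complex_part\<close> is a complex-linear functional on it.  It detects the norm of a vector through
  \<open>complex_part \<langle>x, x\<rangle> = \<parallel>x\<parallel>\<^sup>2\<close>, and so reduces holomorphy of vector-valued maps to scalar functions.
\<close>

definition complex_part :: "quat \<Rightarrow> complex"
  where "complex_part q = Complex (qre q) (qi q)"

lemma complex_part_simps:
  "complex_part (p + q) = complex_part p + complex_part q"
  "complex_part (p - q) = complex_part p - complex_part q"
  "complex_part (r *\<^sub>R p) = r *\<^sub>R complex_part p"
  "complex_part (p * qc c) = complex_part p * c"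
  "complex_part (of_real r) = of_real r"
  by (simp_all add: complex_part_def complex_eq_iff)

lemma cmod_complex_part_le: "cmod (complex_part q) \<le> norm q"
  by (rule power2_le_imp_le) (simp_all add: complex_part_def cmod_power2 quat_norm_squared)

lemma bounded_linear_complex_part: "bounded_linear complex_part"
  by (rule bounded_linear_intro[where K = 1]) (simp_all add: complex_part_simps cmod_complex_part_le)

lemma norm_le_if_complex_part_le:
  assumes "K \<ge> 0" "\<And>y. cmod (complex_part (qinner x y)) \<le> K * norm y"
  shows "norm x \<le> K"
proof (cases "x = 0")
  case False
  have "complex_part (qinner x x) = of_real ((norm x)\<^sup>2)"
    unfolding qinner_self by (rule complex_part_simps)
  then have "norm x * norm x \<le> K * norm x"
    using assms(2)[of x] by (simp add: norm_power power2_eq_square norm_mult)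
  then show ?thesis
    using False by simp
qed (simp add: assms(1))

text \<open>
  Taylor's formula for \<open>deriv g\<close> with Cauchy's bound for the third derivative of \<open>g\<close>.  The right-hand
  side depends on \<open>g\<close> only through its bound \<open>B\<close>, which is what permits uniformity over a family.
\<close>

lemma deriv_difference_quotient_bound:
  assumes g: "g holomorphic_on ball z (2 * r)" and B: "\<And>w. w \<in> ball z (2 * r) \<Longrightarrow> cmod (g w) \<le> B"
    and h: "h \<noteq> 0" "cmod h < r"
  shows "cmod ((deriv g (z + h) - deriv g z) / h - deriv (deriv g) z) \<le> 6 * B / r ^ 3 * cmod h"
proof -
  let ?S = "ball z r" and ?f = "\<lambda>i. (deriv ^^ Suc i) g"
  have r: "r > 0"
    using h norm_ge_zero[of h] by linarith
  have sub: "cball x r \<subseteq> ball z (2 * r)" if "x \<in> ?S" for x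
  proof
    fix y assume "y \<in> cball x r"
    then show "y \<in> ball z (2 * r)"
      using that dist_triangle[of z y x] by simp
  qed
  have "cmod (?f 0 (z + h) - (\<Sum>i\<le>1. ?f i z * (z + h - z) ^ i / fact i))
      \<le> 6 * B / r ^ 3 * cmod (z + h - z) ^ Suc 1 / fact 1"
  proof (rule complex_Taylor[where S = ?S])
    show "(?f i has_field_derivative ?f (Suc i) x) (at x within ?S)" if "x \<in> ?S" for i x
    proof -
      have "(deriv ^^ Suc i) g holomorphic_on ball z (2 * r)"
        by (rule holomorphic_higher_deriv[OF g]) simp
      then have "((deriv ^^ Suc i) g has_field_derivative deriv ((deriv ^^ Suc i) g) x) (at x)"
        using that r by (intro holomorphic_derivI[where S = "ball z (2 * r)"]) auto
      then show ?thesis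
        by (simp add: has_field_derivative_at_within)
    qed
    show "cmod (?f (Suc 1) x) \<le> 6 * B / r ^ 3" if "x \<in> ?S" for x
    proof -
      have "cmod ((deriv ^^ 3) g x) \<le> fact 3 * B / r ^ 3"
      proof (rule Cauchy_inequality[OF _ _ r])
        have "g holomorphic_on cball x r"
          using g sub[OF that] by (rule holomorphic_on_subset)
        then show "continuous_on (cball x r) g" "g holomorphic_on ball x r"
          by (auto intro: holomorphic_on_imp_continuous_on holomorphic_on_subset)
        show "cmod (g y) \<le> B" if "cmod (x - y) = r" for y
          using B[of y] sub[OF \<open>x \<in> ?S\<close>] that by (auto simp: dist_norm subset_iff)
      qed
      then show ?thesis
        by (simp add: fact_numeral numeral_3_eq_3)
    qed
  qed (use r h in \<open>auto simp: dist_norm\<close>)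
  then have "cmod (deriv g (z + h) - deriv g z - deriv (deriv g) z * h) \<le> 6 * B / r ^ 3 * (cmod h)\<^sup>2"
    by (simp add: power2_eq_square diff_diff_eq)
  then have "cmod (deriv g (z + h) - deriv g z - deriv (deriv g) z * h) / cmod h
      \<le> 6 * B / r ^ 3 * (cmod h)\<^sup>2 / cmod h"
    by (rule divide_right_mono) simp
  moreover have "(deriv g (z + h) - deriv g z) / h - deriv (deriv g) z
      = (deriv g (z + h) - deriv g z - deriv (deriv g) z * h) / h"
    using h(1) by (simp add: diff_divide_distrib)
  ultimately show ?thesis
    using h(1) by (simp add: norm_divide power2_eq_square)
qed

text \<open>
  Every scalar function \<open>complex_part \<langle>f w, y\<rangle>\<close> is holomorphic, and Cauchy's estimate for its third
  derivative is uniform over \<open>\<parallel>y\<parallel> \<le> 1\<close>.  Hence the difference quotients of the derivative form a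
  Cauchy net in norm, and completeness supplies the second derivative.
\<close>

lemma right_holomorphic_right_deriv:
  fixes f :: "complex \<Rightarrow> 'a::{quat_inner, complete_space}"
  assumes f: "right_holomorphic_on f S" and S: "open S"
  shows "right_holomorphic_on (right_deriv f) S"
  unfolding right_holomorphic_on_def
proof
  fix z assume "z \<in> S"
  let ?D = "right_deriv f"
  obtain R where R: "R > 0" "cball z R \<subseteq> S"
    using S \<open>z \<in> S\<close> open_contains_cball by blast
  define r where "r = R / 2"
  have r: "r > 0" "ball z (2 * r) \<subseteq> cball z R" "ball z (2 * r) \<subseteq> S"
    using R by (auto simp: r_def)
  have deriv_f: "(f has_derivative (\<lambda>h. ?D w \<cdot>\<^sub>q qc h)) (at w)" if "w \<in> S" for w
    by (rule right_holomorphic_has_derivative[OF f that])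
  have "continuous_on (cball z R) f"
    using deriv_f R(2)
    by (intro continuous_at_imp_continuous_on ballI has_derivative_continuous) blast
  then have "bounded (f ` cball z R)"
    by (intro compact_imp_bounded compact_continuous_image compact_cball)
  then obtain M where M: "\<And>w. w \<in> cball z R \<Longrightarrow> norm (f w) \<le> M"
    unfolding bounded_iff by blast
  define c where "c = 6 * M / r ^ 3"
  have "M \<ge> 0"
    using order_trans[OF norm_ge_zero M[of z]] R(1) by simp
  then have c: "c \<ge> 0"
    using r(1) by (simp add: c_def)
  define X where "X h = (?D (z + h) - ?D z) \<cdot>\<^sub>q inverse (qc h)" for h
  have X: "norm (X h - X k) \<le> c * (cmod h + cmod k)"
    if h: "h \<noteq> 0" "cmod h < r" and k: "k \<noteq> 0" "cmod k < r" for h k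
  proof (rule norm_le_if_complex_part_le)
    show "c * (cmod h + cmod k) \<ge> 0"
      using c by simp
    fix y :: 'a
    define g where "g w = complex_part (qinner (f w) y)" for w
    have lin: "bounded_linear (\<lambda>x. complex_part (qinner x y))"
      by (rule bounded_linear_compose[OF bounded_linear_complex_part
          bounded_bilinear.bounded_linear_left[OF bounded_bilinear_qinner]])
    have g: "(g has_field_derivative complex_part (qinner (?D w) y)) (at w)" if "w \<in> S" for w
    proof -
      have "(g has_derivative (\<lambda>h. complex_part (qinner (?D w \<cdot>\<^sub>q qc h) y))) (at w)"
        unfolding g_def by (rule bounded_linear.has_derivative[OF lin deriv_f[OF that]])
      then show ?thesis
        by (simp add: has_field_derivative_def qinner_qscale_left complex_part_simps mult_commute_abs)
    qed
    have dg: "deriv g w = complex_part (qinner (?D w) y)" if "w \<in> S" for w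
      using g[OF that] by (rule DERIV_imp_deriv)
    have hol: "g holomorphic_on ball z (2 * r)"
      using g r(3) by (auto simp: holomorphic_on_open)
    have B: "cmod (g w) \<le> M * norm y" if "w \<in> ball z (2 * r)" for w
    proof -
      have "cmod (g w) \<le> norm (f w) * norm y"
        unfolding g_def using cmod_complex_part_le norm_qinner_le order_trans by blast
      also have "\<dots> \<le> M * norm y"
        using that r(2) by (intro mult_right_mono M) auto
      finally show ?thesis .
    qed
    have quotient: "complex_part (qinner (X u) y) = (deriv g (z + u) - deriv g z) / u"
      if "cmod u < r" for u
    proof -
      have "z + u \<in> S"
        using that r(1,3) by (auto simp: dist_norm)
      then show ?thesis
        using dg[of "z + u"] dg[OF \<open>z \<in> S\<close>]
        by (simp add: X_def qinner_qscale_left qinner_diff_left complex_part_simps divide_inverse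
            flip: quat_of_complex_inverse)
    qed
    have "cmod (complex_part (qinner (X h - X k) y))
        = cmod (((deriv g (z + h) - deriv g z) / h - deriv (deriv g) z)
            - ((deriv g (z + k) - deriv g z) / k - deriv (deriv g) z))"
      using quotient[OF h(2)] quotient[OF k(2)] by (simp add: qinner_diff_left complex_part_simps)
    also have "\<dots> \<le> 6 * (M * norm y) / r ^ 3 * cmod h + 6 * (M * norm y) / r ^ 3 * cmod k"
      by (rule order_trans[OF norm_triangle_ineq4])
         (intro add_mono deriv_difference_quotient_bound[OF hol B] h k)
    also have "\<dots> = c * (cmod h + cmod k) * norm y"
      by (simp add: c_def algebra_simps add_divide_distrib)
    finally show "cmod (complex_part (qinner (X h - X k) y)) \<le> c * (cmod h + cmod k) * norm y" .
  qed
  define k where "k n = complex_of_real (r / (real n + 2))" for n :: nat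
  have norm_k: "cmod (k n) = r / (real n + 2)" for n
    unfolding k_def norm_of_real using r(1) by simp
  have k: "k n \<noteq> 0" "cmod (k n) < r" for n
  proof -
    have "0 < r / (real n + 2)" "r / (real n + 2) < r"
      using r(1) by (simp_all add: divide_less_eq)
    then show "k n \<noteq> 0" "cmod (k n) < r"
      unfolding norm_k[symmetric] by simp_all
  qed
  have k0: "(\<lambda>n. c * cmod (k n)) \<longlonglongrightarrow> 0"
    unfolding norm_k by real_asymp
  have "Cauchy (\<lambda>n. X (k n))"
  proof (rule metric_CauchyI)
    fix e :: real assume "e > 0"
    then have "\<forall>\<^sub>F n in sequentially. c * cmod (k n) < e / 2"
      using k0 by (intro order_tendstoD) auto
    then obtain N where N: "\<And>n. n \<ge> N \<Longrightarrow> c * cmod (k n) < e / 2"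
      unfolding eventually_sequentially by blast
    have "dist (X (k m)) (X (k n)) < e" if "m \<ge> N" "n \<ge> N" for m n
      using X[OF k k, of m n] N[OF that(1)] N[OF that(2)] by (simp add: dist_norm distrib_left)
    then show "\<exists>N. \<forall>m\<ge>N. \<forall>n\<ge>N. dist (X (k m)) (X (k n)) < e"
      by blast
  qed
  then obtain L where L: "(\<lambda>n. X (k n)) \<longlonglongrightarrow> L"
    using Cauchy_convergent convergent_def by blast
  have XL: "norm (X h - L) \<le> c * cmod h" if h: "h \<noteq> 0" "cmod h < r" for h
  proof (rule LIMSEQ_le)
    show "(\<lambda>n. norm (X h - X (k n))) \<longlonglongrightarrow> norm (X h - L)"
      by (intro tendsto_norm tendsto_diff tendsto_const L)
    show "(\<lambda>n. c * cmod h + c * cmod (k n)) \<longlonglongrightarrow> c * cmod h"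
      using tendsto_add[OF tendsto_const k0, of "c * cmod h"] by simp
    show "\<exists>N. \<forall>n\<ge>N. norm (X h - X (k n)) \<le> c * cmod h + c * cmod (k n)"
      using X[OF h k] by (auto simp: distrib_left)
  qed
  have "(X \<longlongrightarrow> L) (at 0)"
  proof (rule Lim_transform2[OF tendsto_const], rule Lim_null_comparison)
    show "\<forall>\<^sub>F h in at 0. norm (L - X h) \<le> c * cmod h"
      unfolding eventually_at using r(1) XL
      by (intro exI[of _ r]) (auto simp: dist_norm norm_minus_commute)
    have "((\<lambda>h. c * cmod h) \<longlongrightarrow> c * cmod 0) (at 0)"
      by (intro tendsto_intros)
    then show "((\<lambda>h. c * cmod h) \<longlongrightarrow> 0) (at 0)"
      by simp
  qed
  then show "\<exists>D. has_right_deriv ?D D z"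
    unfolding has_right_deriv_def X_def by blast
qed

lemma right_holomorphic_funpow_right_deriv:
  fixes f :: "complex \<Rightarrow> 'a::{quat_inner, complete_space}"
  assumes "right_holomorphic_on f S" "open S"
  shows "right_holomorphic_on ((right_deriv ^^ n) f) S"
  by (induction n) (simp_all add: assms right_holomorphic_right_deriv)


section \<open>Frames and their Taylor coefficients\<close>

text \<open>
  Differentiating \<open>(T\<^sup>2 - 2 Re(\<omega>) T + |\<omega>|\<^sup>2) \<gamma>(\<omega>) = 0\<close> in the directions \<open>1\<close> and \<open>i\<close> gives two
  expressions for the image of \<open>\<gamma>'(\<omega>)\<close>; comparing them shows that holomorphy selects the eigenspace
  of \<open>\<omega>\<close>, and not that of \<open>cnj \<omega>\<close>, inside the kernel.
\<close>

lemma frame_eigenvector: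
  fixes T :: "'a::quat_inner \<Rightarrow> 'a"
  assumes T: "T \<in> Lr" and frame: "right_holomorphic_frame \<Omega> T \<Delta> \<gamma>" and z: "z \<in> \<Delta>"
  shows "T (\<gamma> z) = \<gamma> z \<cdot>\<^sub>q qc z"
proof -
  define D where "D = right_deriv \<gamma> z"
  have \<gamma>: "(\<gamma> has_derivative (\<lambda>h. D \<cdot>\<^sub>q qc h)) (at z)"
    unfolding D_def using frame z
    by (intro right_holomorphic_has_derivative[of _ \<Delta>]) (auto simp: right_holomorphic_frame_def)
  let ?Q = "qpoly T (qc z)"
  define F where "F w = T (T (\<gamma> w)) - (2 * Re w) *\<^sub>R T (\<gamma> w) + ((Re w)\<^sup>2 + (Im w)\<^sup>2) *\<^sub>R \<gamma> w" for w
  note TD = bounded_linear.has_derivative[OF Lr_bounded_linear[OF T]]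
  have "(F has_derivative (\<lambda>h. T (T (D \<cdot>\<^sub>q qc h))
      - ((2 * Re z) *\<^sub>R T (D \<cdot>\<^sub>q qc h) + (2 * Re h) *\<^sub>R T (\<gamma> z))
      + (((Re z)\<^sup>2 + (Im z)\<^sup>2) *\<^sub>R (D \<cdot>\<^sub>q qc h) + (2 * Re h * Re z + 2 * Im h * Im z) *\<^sub>R \<gamma> z))) (at z)"
    unfolding F_def
    by (rule has_derivative_eq_rhs, (rule derivative_intros TD \<gamma>)+) (auto simp: fun_eq_iff)
  then have zero: "T (T (D \<cdot>\<^sub>q qc h)) - ((2 * Re z) *\<^sub>R T (D \<cdot>\<^sub>q qc h) + (2 * Re h) *\<^sub>R T (\<gamma> z))
      + (((Re z)\<^sup>2 + (Im z)\<^sup>2) *\<^sub>R (D \<cdot>\<^sub>q qc h) + (2 * Re h * Re z + 2 * Im h * Im z) *\<^sub>R \<gamma> z) = 0" for h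
    by (rule has_derivative_zero_if_locally_zero[where S = \<Delta>])
       (use frame z in \<open>auto simp: right_holomorphic_frame_def qker_def qpoly_def F_def cmod_power2\<close>)
  have 1: "?Q D = 2 *\<^sub>R (T (\<gamma> z) - Re z *\<^sub>R \<gamma> z)"
    using zero[of 1] by (simp add: qpoly_def cmod_power2 algebra_simps scaleR_2)
  have "?Q (D \<cdot>\<^sub>q qc \<i>) = - 2 *\<^sub>R (Im z *\<^sub>R \<gamma> z)"
    using zero[of \<i>] by (simp add: qpoly_def cmod_power2 algebra_simps eq_neg_iff_add_eq_0)
  then have "(2 *\<^sub>R (T (\<gamma> z) - Re z *\<^sub>R \<gamma> z)) \<cdot>\<^sub>q qc \<i> = - 2 *\<^sub>R (Im z *\<^sub>R \<gamma> z)"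
    by (simp only: Lr_linear(5)[OF qpoly_Lr[OF T]] 1)
  then have "2 *\<^sub>R ((T (\<gamma> z) - Re z *\<^sub>R \<gamma> z) \<cdot>\<^sub>q qc \<i> + Im z *\<^sub>R \<gamma> z) = 0"
    unfolding scaleR_add_right[of 2] qscale_scaleR_left by simp
  then have "(T (\<gamma> z) - Re z *\<^sub>R \<gamma> z) \<cdot>\<^sub>q qc \<i> = - (Im z *\<^sub>R \<gamma> z)"
    by (simp only: scaleR_eq_0_iff eq_neg_iff_add_eq_0) simp
  then have "((T (\<gamma> z) - Re z *\<^sub>R \<gamma> z) \<cdot>\<^sub>q qc \<i>) \<cdot>\<^sub>q qc (- \<i>) = - (Im z *\<^sub>R \<gamma> z) \<cdot>\<^sub>q qc (- \<i>)"
    by simp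
  then have "T (\<gamma> z) - Re z *\<^sub>R \<gamma> z = (\<gamma> z \<cdot>\<^sub>q of_real (Im z)) \<cdot>\<^sub>q qc \<i>"
    by (simp only: qscale_of_real qscale_qscale)
       (simp add: qscale_minus_left qscale_minus_right flip: quat_of_complex_mult)
  then have "T (\<gamma> z) = \<gamma> z \<cdot>\<^sub>q (of_real (Re z) + of_real (Im z) * qc \<i>)"
    by (simp add: qscale_add_right qscale_of_real algebra_simps flip: qscale_qscale)
  also have "of_real (Re z) + of_real (Im z) * qc \<i> = qc z"
    by (simp add: quat_eq_iff)
  finally show ?thesis .
qed

text \<open>
  The \<open>n\<close>-th derivative of \<open>T \<gamma>(z) = \<gamma>(z) z\<close>.  For \<open>n = 0\<close> the truncated \<open>n - 1\<close> is harmless because its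
  term carries the factor 0.
\<close>

lemma frame_derivatives_jordan:
  fixes T :: "'a::{quat_inner, complete_space} \<Rightarrow> 'a"
  assumes T: "T \<in> Lr" and frame: "right_holomorphic_frame \<Omega> T \<Delta> \<gamma>" and "z \<in> \<Delta>"
  shows "T ((right_deriv ^^ n) \<gamma> z)
    = (right_deriv ^^ n) \<gamma> z \<cdot>\<^sub>q qc z + real n *\<^sub>R (right_deriv ^^ (n - 1)) \<gamma> z"
  using \<open>z \<in> \<Delta>\<close>
proof (induction n arbitrary: z)
  case 0
  then show ?case
    by (simp add: frame_eigenvector[OF T frame])
next
  case (Suc n)
  let ?g = "\<lambda>n. (right_deriv ^^ n) \<gamma>"
  have \<Delta>: "open \<Delta>" "right_holomorphic_on \<gamma> \<Delta>"
    using frame by (auto simp: right_holomorphic_frame_def)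
  have g: "(?g m has_derivative (\<lambda>h. ?g (Suc m) z \<cdot>\<^sub>q qc h)) (at z)" for m
    using right_holomorphic_has_derivative[OF right_holomorphic_funpow_right_deriv[OF \<Delta>(2,1)] Suc.prems]
    by simp
  note TD = bounded_linear.has_derivative[OF Lr_bounded_linear[OF T]]
  note mult = bounded_bilinear.FDERIV[OF bounded_bilinear_qscale]
  have id: "(qc has_derivative qc) (at z)"
    by (rule bounded_linear_imp_has_derivative[OF bounded_linear_quat_of_complex])
  let ?F = "\<lambda>w. T (?g n w) - (?g n w \<cdot>\<^sub>q qc w + real n *\<^sub>R ?g (n - 1) w)"
  have "(?F has_derivative (\<lambda>h. T (?g (Suc n) z \<cdot>\<^sub>q qc h)
      - (?g n z \<cdot>\<^sub>q qc h + (?g (Suc n) z \<cdot>\<^sub>q qc h) \<cdot>\<^sub>q qc z + real n *\<^sub>R (?g (Suc (n - 1)) z \<cdot>\<^sub>q qc h)))) (at z)"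
    by (intro has_derivative_diff has_derivative_add has_derivative_scaleR_right TD mult g id)
  then have "T (?g (Suc n) z \<cdot>\<^sub>q qc 1)
      - (?g n z \<cdot>\<^sub>q qc 1 + (?g (Suc n) z \<cdot>\<^sub>q qc 1) \<cdot>\<^sub>q qc z + real n *\<^sub>R (?g (Suc (n - 1)) z \<cdot>\<^sub>q qc 1)) = 0"
    by (rule has_derivative_zero_if_locally_zero[OF _ \<Delta>(1) Suc.prems]) (simp add: Suc.IH)
  moreover have "real n *\<^sub>R ?g (Suc (n - 1)) z = real n *\<^sub>R ?g n z"
    by (cases n) auto
  ultimately show ?case
    by (simp del: funpow.simps add: algebra_simps)
qed

lemma frame_taylor_chain:
  fixes T :: "'a::{quat_inner, complete_space} \<Rightarrow> 'a"
  assumes T: "T \<in> Lr" and frame: "right_holomorphic_frame \<Omega> T \<Delta> \<gamma>" and z: "z \<in> \<Delta>"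
  shows "jordan_chain T z (\<lambda>n. (right_deriv ^^ n) \<gamma> z /\<^sub>R fact n)"
  unfolding jordan_chain_def
proof (intro conjI allI)
  let ?g = "\<lambda>n. (right_deriv ^^ n) \<gamma> z"
  show "?g 0 /\<^sub>R fact 0 \<noteq> 0"
    using frame z by (auto simp: right_holomorphic_frame_def)
  show "eigshift T z (?g 0 /\<^sub>R fact 0) = 0"
    using frame_eigenvector[OF T frame z] by (simp add: eigshift_eq_0_iff)
  show "eigshift T z (?g (Suc n) /\<^sub>R fact (Suc n)) = ?g n /\<^sub>R fact n" for n
  proof -
    have "eigshift T z (?g (Suc n) /\<^sub>R fact (Suc n)) = (inverse (fact (Suc n)) * real (Suc n)) *\<^sub>R ?g n"
      using frame_derivatives_jordan[OF T frame z, of "Suc n"]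
      by (simp add: eigshift_def Lr_linear[OF T] qscale_scaleR_left flip: scaleR_diff_right
          del: funpow.simps fact_Suc of_nat_Suc)
    also have "inverse (fact (Suc n)) * real (Suc n) = inverse (fact n)"
      by (simp add: divide_simps del: of_nat_Suc)
    finally show ?thesis .
  qed
qed

text \<open>
  Dividing the derivatives by the positive factorials does not change the outcome of Gram--Schmidt,
  so the canonical matrix can be computed from the Jordan chain.
\<close>

lemma canonical_matrix_jordan_chain:
  fixes T :: "'a::{quat_inner, complete_space} \<Rightarrow> 'a"
  assumes T: "T \<in> Lr" and N: "canonical_matrix \<Omega> T z N"
  obtains a where "jordan_chain T z a"
    "N = (\<lambda>j k. qinner (T (qgram_schmidt a k)) (qgram_schmidt a j))"
proof -
  obtain \<Delta> \<gamma> where frame: "right_holomorphic_frame \<Omega> T \<Delta> \<gamma>" and z: "z \<in> \<Delta>"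
    and N': "N = (\<lambda>j k. qinner (T (qgram_schmidt (\<lambda>i. (right_deriv ^^ i) \<gamma> z) k))
      (qgram_schmidt (\<lambda>i. (right_deriv ^^ i) \<gamma> z) j))"
    using N by (auto simp: canonical_matrix_def Let_def)
  let ?g = "\<lambda>n. (right_deriv ^^ n) \<gamma> z"
  let ?a = "\<lambda>n. ?g n /\<^sub>R fact n"
  have "qgram_schmidt ?g n = qgram_schmidt ?a n \<cdot>\<^sub>q 1" for n
  proof (rule qgram_schmidt_triangular)
    show "\<exists>r>0. ?g n - ?a n \<cdot>\<^sub>q (r *\<^sub>R 1) \<in> qspan (?a ` {..<n})" for n
      by (intro exI[of _ "fact n"]) (simp add: qscale_scaleR_right qspanD(1))
  qed simp
  then show ?thesis
    using that[OF frame_taylor_chain[OF T frame z]] N' by simp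
qed


section \<open>Unitary equivalence\<close>

lemma qgram_schmidt_isometry:
  assumes U: "U \<in> Lr" and iso: "\<And>x y. qinner (U x) (U y) = qinner x y"
  shows "qgram_schmidt (\<lambda>n. U (f n)) n = U (qgram_schmidt f n)"
proof (induction n rule: less_induct)
  case (less n)
  have "(norm (U x))\<^sup>2 = (norm x)\<^sup>2" for x
    using iso[of x x] by (simp only: qinner_self of_real_eq_iff)
  then have norm_U: "norm (U x) = norm x" for x
    by simp
  have "qproj (qgram_schmidt (\<lambda>n. U (f n))) n (U x) = U (qproj (qgram_schmidt f) n x)" for x
    unfolding qproj_def Lr_linear[OF U] using less.IH by (intro sum.cong) (simp_all add: iso)
  then show ?case
    by (subst (1 2) qgram_schmidt_residual)
       (simp add: norm_U Lr_linear[OF U] flip: Lr_linear(2)[OF U])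
qed

text \<open>
  The last equation expresses the invariance of the initial segments: column \<open>k\<close> of the canonical
  matrix vanishes below the diagonal.
\<close>

lemma jordan_chain_orthonormal_basis:
  fixes T :: "'a::{quat_inner, complete_space} \<Rightarrow> 'a"
  assumes \<Omega>: "axially_symmetric \<Omega>" "\<Omega> \<inter> \<real> = {}" "open \<Omega>" "connected \<Omega>"
    and B1s: "T \<in> B1s \<Omega>" and z: "z \<in> reduced \<Omega>" and a: "jordan_chain T z a"
  shows "qorthonormal (qgram_schmidt a)" "closure (qspan (range (qgram_schmidt a))) = UNIV"
    "T (qgram_schmidt a k) =
      (\<Sum>j<Suc k. qgram_schmidt a j \<cdot>\<^sub>q qinner (T (qgram_schmidt a k)) (qgram_schmidt a j))"
proof -
  interpret simple_sphere T z
    using B1s_simple_sphere[OF \<Omega>(1,2) B1s z] .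
  show "qorthonormal (qgram_schmidt a)"
    by (intro qorthonormal_qgram_schmidt jordan_chain_independent[OF T a Im_nonzero])
  show "closure (qspan (range (qgram_schmidt a))) = UNIV"
    using jordan_chain_total[OF \<Omega> B1s z a]
    by (simp add: qspan_range_UN qspan_qgram_schmidt)
  have "qgram_schmidt a k \<in> qspan (qgram_schmidt a ` {..<Suc k})"
    by (rule qspan_base) auto
  then have "T (qgram_schmidt a k) \<in> qspan (qgram_schmidt a ` {..<Suc k})"
    using jordan_chain_invariant[OF T a, of "Suc k"] unfolding qspan_qgram_schmidt by blast
  then show "T (qgram_schmidt a k) =
      (\<Sum>j<Suc k. qgram_schmidt a j \<cdot>\<^sub>q qinner (T (qgram_schmidt a k)) (qgram_schmidt a j))"
    using qproj_on_qspan[OF qgram_schmidt_orthogonal_units, of _ a "Suc k"]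
    by (simp only: qproj_def)
qed

theorem theorem5p4:
  fixes \<Omega>q :: "quat set"
    and T1 T2 :: "'a::{quat_inner, complete_space} \<Rightarrow> 'a"
    and \<omega>0 :: complex
    and N1 N2 :: "nat \<Rightarrow> nat \<Rightarrow> quat"
  assumes "separable_space (euclidean :: 'a topology)"
    and "open \<Omega>q" and "connected \<Omega>q" and "axially_symmetric \<Omega>q" and "\<Omega>q \<inter> \<real> = {}"
    and "T1 \<in> B1s \<Omega>q" and "T2 \<in> B1s \<Omega>q"
    and "\<omega>0 \<in> reduced \<Omega>q"
    and "canonical_matrix \<Omega>q T1 \<omega>0 N1" and "canonical_matrix \<Omega>q T2 \<omega>0 N2"
  shows "quat_unitarily_equivalent T1 T2 \<longleftrightarrow>
    (\<exists>\<theta>\<in>{0..<2 * pi}. N2 = (\<lambda>j k. quat_of_complex (exp (- \<i> * complex_of_real \<theta>)) * N1 j k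
                                  * quat_of_complex (exp (\<i> * complex_of_real \<theta>))))"
proof -
  note \<Omega> = assms(4,5,2,3)
  have T1: "T1 \<in> Lr" and T2: "T2 \<in> Lr"
    using assms(6,7) by (simp_all add: B1s_def)
  obtain a1 where a1: "jordan_chain T1 \<omega>0 a1"
    and N1: "N1 = (\<lambda>j k. qinner (T1 (qgram_schmidt a1 k)) (qgram_schmidt a1 j))"
    using canonical_matrix_jordan_chain[OF T1 assms(9)] .
  obtain a2 where a2: "jordan_chain T2 \<omega>0 a2"
    and N2: "N2 = (\<lambda>j k. qinner (T2 (qgram_schmidt a2 k)) (qgram_schmidt a2 j))"
    using canonical_matrix_jordan_chain[OF T2 assms(10)] .
  let ?e1 = "qgram_schmidt a1" and ?e2 = "qgram_schmidt a2"
  note e1 = jordan_chain_orthonormal_basis[OF \<Omega> assms(6,8) a1]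
  note e2 = jordan_chain_orthonormal_basis[OF \<Omega> assms(7,8) a2]
  have cnj_phase: "cnj (exp (\<i> * complex_of_real \<theta>)) = exp (- \<i> * complex_of_real \<theta>)" for \<theta>
    by (simp add: exp_cnj)
  show ?thesis
  proof
    assume "quat_unitarily_equivalent T1 T2"
    then obtain U V where U: "U \<in> Lr" and adj: "is_qadjoint U V" and VU: "V \<circ> U = id"
      and UT: "U \<circ> T1 = T2 \<circ> U"
      unfolding quat_unitarily_equivalent_def by blast
    have intertwine: "T2 (U x) = U (T1 x)" for x
      using UT by (metis comp_apply)
    have iso: "qinner (U x) (U y) = qinner x y" for x y
      using adj VU unfolding is_qadjoint_def by (metis comp_apply id_apply)
    interpret simple_sphere T2 \<omega>0
      by (rule B1s_simple_sphere[OF assms(4,5,7,8)])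
    have "U x \<noteq> 0" if "x \<noteq> 0" for x
      using that VU Lr_linear(3) by (metis comp_apply id_apply U iso qinner_self qinner_zero_left norm_eq_zero of_real_eq_0_iff power_eq_0_iff)
    then have Ua: "jordan_chain T2 \<omega>0 (\<lambda>n. U (a1 n))"
      using a1 by (simp add: jordan_chain_def eigshift_def intertwine Lr_linear[OF U]
          flip: Lr_linear(2,5)[OF U])
    obtain c where c: "c \<noteq> 0"
      "\<And>n. a2 n - U (a1 n) \<cdot>\<^sub>q qc c \<in> qspan ((\<lambda>n. U (a1 n)) ` {..<n})"
      using jordan_chain_unique[OF Ua a2] by blast
    define \<theta> where "\<theta> = Arg2pi c"
    define u where "u = exp (\<i> * complex_of_real \<theta>)"
    have \<theta>: "\<theta> \<in> {0..<2 * pi}" and cu: "c = complex_of_real (cmod c) * u"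
      using Arg2pi[of c] by (simp_all add: \<theta>_def u_def is_Arg_def)
    \<comment> \<open>Two chains of \<open>T2\<close>, the given one and the image of that of \<open>T1\<close>, differ by the phase \<open>u\<close>.\<close>
    have e2_e1: "?e2 n = U (?e1 n) \<cdot>\<^sub>q qc u" for n
      unfolding qgram_schmidt_isometry[OF U iso, symmetric]
    proof (rule qgram_schmidt_triangular)
      show "\<exists>r>0. a2 n - U (a1 n) \<cdot>\<^sub>q (r *\<^sub>R qc u) \<in> qspan ((\<lambda>n. U (a1 n)) ` {..<n})" for n
      proof (intro exI conjI)
        have "cmod c *\<^sub>R qc u = qc (complex_of_real (cmod c) * u)"
          by (simp add: quat_eq_iff)
        then show "a2 n - U (a1 n) \<cdot>\<^sub>q (cmod c *\<^sub>R qc u) \<in> qspan ((\<lambda>n. U (a1 n)) ` {..<n})"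
          using c(2)[of n] cu by simp
      qed (simp add: c(1))
    qed (simp add: u_def)
    have "N2 j k = qc (cnj u) * N1 j k * qc u" for j k
      unfolding N1 N2 e2_e1
      by (simp add: Lr_linear[OF T2] qinner_qscale_left qinner_qscale_right intertwine iso mult.assoc)
    then show "\<exists>\<theta>\<in>{0..<2 * pi}. N2 = (\<lambda>j k. qc (exp (- \<i> * complex_of_real \<theta>)) * N1 j k
        * qc (exp (\<i> * complex_of_real \<theta>)))"
      using \<theta> unfolding u_def cnj_phase by blast
  next
    assume "\<exists>\<theta>\<in>{0..<2 * pi}. N2 = (\<lambda>j k. qc (exp (- \<i> * complex_of_real \<theta>)) * N1 j k
        * qc (exp (\<i> * complex_of_real \<theta>)))"
    then obtain \<theta> where N2_N1: "N2 = (\<lambda>j k. qc (exp (- \<i> * complex_of_real \<theta>)) * N1 j k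
        * qc (exp (\<i> * complex_of_real \<theta>)))"
      by blast
    define u where "u = exp (\<i> * complex_of_real \<theta>)"
    have u: "qc u * qc (cnj u) = 1"
      by (simp add: u_def cnj_phase flip: quat_of_complex_mult exp_add)
    have N21: "N2 j k = qc (cnj u) * N1 j k * qc u" for j k
      unfolding N2_N1 u_def cnj_phase ..
    \<comment> \<open>Undo the phase, so that both operators have the same matrix.\<close>
    define e' where "e' k = ?e2 k \<cdot>\<^sub>q qc (cnj u)" for k
    have e2_e': "?e2 k = e' k \<cdot>\<^sub>q qc u" for k
      using u by (simp add: e'_def qscale_qscale quat_of_complex_commute)
    have orth: "qorthonormal e'"
      using e2(1) u by (auto simp: qorthonormal_def e'_def qinner_qscale_left qinner_qscale_right)
    have "range ?e2 \<subseteq> qspan (range e')"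
      unfolding e2_e' by (auto intro!: qspanD(3)[OF qspan_base])
    then have "qspan (range ?e2) \<subseteq> qspan (range e')"
      by (intro qspan_minimal qsubspace_qspan)
    then have dense: "closure (qspan (range e')) = UNIV"
      using e2(2) closure_mono by blast
    obtain U V where U: "U \<in> Lr" "V \<in> Lr" "is_qadjoint U V" "V \<circ> U = id" "U \<circ> V = id"
      "\<And>k. U (?e1 k) = e' k"
      using unitary_between_orthonormal_bases[OF e1(1,2) orth dense] by blast
    have "U \<circ> T1 = T2 \<circ> U"
    proof (rule Lr_eq_on_dense[OF Lr_comp[OF U(1) T1] Lr_comp[OF T2 U(1)] _ e1(2)])
      fix x assume "x \<in> range ?e1"
      then obtain k where x: "x = ?e1 k"
        by auto
      have "U (T1 (?e1 k)) = U (\<Sum>j<Suc k. ?e1 j \<cdot>\<^sub>q N1 j k)"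
        unfolding N1 by (subst e1(3)) rule
      also have "\<dots> = (\<Sum>j<Suc k. ?e2 j \<cdot>\<^sub>q (qc (cnj u) * N1 j k))"
        unfolding Lr_linear[OF U(1)] U(6) e'_def qscale_qscale ..
      also have "\<dots> = (\<Sum>j<Suc k. ?e2 j \<cdot>\<^sub>q N2 j k) \<cdot>\<^sub>q qc (cnj u)"
        unfolding qscale_sum_left qscale_qscale N21 mult.assoc u by simp
      also have "\<dots> = T2 (?e2 k) \<cdot>\<^sub>q qc (cnj u)"
        unfolding N2 by (subst e2(3)) rule
      also have "\<dots> = T2 (U (?e1 k))"
        by (simp add: U(6) e'_def Lr_linear[OF T2])
      finally show "(U \<circ> T1) x = (T2 \<circ> U) x"
        by (simp add: x)
    qed
    with U show "quat_unitarily_equivalent T1 T2"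
      unfolding quat_unitarily_equivalent_def by blast
  qed
qed

end
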